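(* Let $\mathrm{d}+A$ be an $\mathfrak{sl}_2$-connection on the formal punctured disc with associated symmetric matrices $C_k$, $k\in\mathbb{Z}$. The operators in $\mathcal{SF}_{\mathrm{d}+A}$ $$L_{n}^{\mathrm{d}+A}:=\sum_{i+j=n}:\psi_i^-\psi_j^+:\;+\;c_n1,\qquad c_n=\frac12\sum_{i+j=n}\left(C_{i}^{-+}C_{j}^{+-}+C_{i}^{++}C_{j}^{--}\right),\qquad n\in\mathbb{Z},$$ fulfill the relations of the Virasoro algebra at central charge $c=-2$, i.e. $$[L_m^{\mathrm{d}+A},L_n^{\mathrm{d}+A}]=(m-n)L_{m+n}^{\mathrm{d}+A}-\frac{m^3-m}{6}\,\delta_{m+n,0}.$$
   Context: All algebras are over $\mathbb{C}$. Indices $a,b\in\{+,-\}$; $\mathbb{C}^2$ has basis $e^+,e^-$ and symplectic form $(e^+,e^-)=1=-(e^-,e^+)$, $(e^\pm,e^\pm)=0$. The connection is $\mathrm{d}+A$ with $A(z)=\sum_{k\in\mathbb{Z}}A_kz^{-k-1}$, $A_k\in\mathfrak{sl}_2(\mathbb{C})$, with a pole of finite order, i.e. $A_k=0$ for all sufficiently large $k$. Put $C_k=\begin{pmatrix}0&-1\\1&0\end{pmatrix}A_k$ (rows and columns indexed by $+,-$ in this order), a symmetric matrix with entries $C_k^{ab}$. $\mathcal{SF}_{\mathrm{d}+A}$ is the unital associative (Clifford) algebra with generators $\psi^\pm_n$, $n\in\mathbb{Z}$, and relations $\{\psi^a_m,\psi^b_n\}=m\,(e^a,e^b)\,\delta_{m+n,0}+C_{m+n}^{ab}$,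 where $\{x,y\}=xy+yx$. Normal ordering: $:\psi_i^a\psi_j^b:\;=\psi_i^a\psi_j^b$ if $i<j$, $-\psi_j^b\psi_i^a$ if $i>j$, and $\frac12(\psi_i^a\psi_j^b-\psi_j^b\psi_i^a)$ if $i=j$. The infinite sums are understood as operators on $\mathcal{SF}_{\mathrm{d}+A}$-modules in which every vector is annihilated by $\psi_n^\pm$ for all sufficiently large $n$ (so that the sum defining $L_n^{\mathrm{d}+A}$ is finite on each vector), and the relations are asserted for these operators.
   Formalization: In c_n the term C_i^{++}C_j^{--} enters with a minus sign instead of the printed plus; with the plus sign and the stated conventions the relations fail, e.g. for A(z)=A_0/z with C_0^{++}C_0^{--} nonzero. *)

theory Defs
  imports
    "HOL-Analysis.Analysis"
    "HOL-Library.Poly_Mapping"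
    "HOL-Library.Groups_Big_Fun"
    "HOL-Algebra.QuotRing"
    "HOL-Algebra.Algebraic_Closure_Type"
begin

no_notation fps_nth (infixl "$" 75)

section \<open>The connection and the matrices \<open>C\<^sub>k\<close>\<close>

datatype pm = Plus | Minus

instance pm :: finite
proof
  have "(UNIV :: pm set) \<subseteq> {Plus, Minus}"
    using pm.exhaust by blast
  then show "finite (UNIV :: pm set)"
    using finite_subset by blast
qed

fun omega :: "pm \<Rightarrow> pm \<Rightarrow> complex" where
  "omega Plus Minus = 1"
| "omega Minus Plus = - 1"
| "omega Plus Plus = 0"
| "omega Minus Minus = 0"

text \<open>
  A connection \<open>d + A\<close> with \<open>A(z) = \<Sum>k. A\<^sub>k z\<^sup>-\<^sup>k\<^sup>-\<^sup>1\<close> is given by its coefficients \<open>A\<^sub>k\<close>.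
  There is no bound for \<open>k \<rightarrow> -\<infinity>\<close>, since the disc is formal.
\<close>

definition sl2_connection :: "(int \<Rightarrow> complex^pm^pm) \<Rightarrow> bool" where
  "sl2_connection A \<longleftrightarrow> (\<forall>k. trace (A k) = 0) \<and> (\<exists>N. \<forall>k\<ge>N. A k = 0)"

definition Jmat :: "complex^pm^pm" where
  "Jmat = (\<chi> a b. case (a, b) of (Plus, Minus) \<Rightarrow> - 1 | (Minus, Plus) \<Rightarrow> 1 | _ \<Rightarrow> 0)"

definition Cmat :: "(int \<Rightarrow> complex^pm^pm) \<Rightarrow> int \<Rightarrow> complex^pm^pm" where
  "Cmat A k = Jmat ** A k"

section \<open>The algebra \<open>SF\<^bsub>d+A\<^esub>\<close>\<close>

text \<open>
  The free unital associative algebra on generators \<open>'g\<close> is the monoid algebra of the free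
  monoid on \<open>'g\<close>. The monoid is written additively, because the product on
  \<^typ>\<open>'m \<Rightarrow>\<^sub>0 complex\<close> is the convolution product for \<open>+\<close> on \<open>'m\<close>.
\<close>

datatype 'g fword = Word (letters: "'g list")

instantiation fword :: (type) monoid_add
begin
definition "0 = Word []"
definition "u + v = Word (letters u @ letters v)"
instance by standard (auto simp: zero_fword_def plus_fword_def)
end

type_synonym 'g free_alg = "'g fword \<Rightarrow>\<^sub>0 complex"

definition gen :: "'g \<Rightarrow> 'g free_alg" where
  "gen x = Poly_Mapping.single (Word [x]) 1"

definition const :: "complex \<Rightarrow> 'g free_alg" where
  "const c = Poly_Mapping.single 0 c"

abbreviation FA :: "(pm \<times> int) free_alg ring" where
  "FA \<equiv> ring_of_type_algebra"

definition SF_relators :: "(int \<Rightarrow> complex^pm^pm) \<Rightarrow> (pm \<times> int) free_alg set" where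
  "SF_relators A =
    {gen (a, m) * gen (b, n) + gen (b, n) * gen (a, m)
       - const ((if m + n = 0 then of_int m * omega a b else 0) + Cmat A (m + n) $ a $ b)
     | a b m n. True}"

definition SF_ideal :: "(int \<Rightarrow> complex^pm^pm) \<Rightarrow> (pm \<times> int) free_alg set" where
  "SF_ideal A = genideal FA (SF_relators A)"

definition SF :: "(int \<Rightarrow> complex^pm^pm) \<Rightarrow> (pm \<times> int) free_alg set ring" where
  "SF A = FA Quot SF_ideal A"

definition psi :: "(int \<Rightarrow> complex^pm^pm) \<Rightarrow> pm \<Rightarrow> int \<Rightarrow> (pm \<times> int) free_alg set" where
  "psi A a n = SF_ideal A +>\<^bsub>FA\<^esub> gen (a, n)"

definition scal :: "(int \<Rightarrow> complex^pm^pm) \<Rightarrow> complex \<Rightarrow> (pm \<times> int) free_alg set" where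
  "scal A c = SF_ideal A +>\<^bsub>FA\<^esub> const c"

definition normal_ord ::
  "(int \<Rightarrow> complex^pm^pm) \<Rightarrow> pm \<Rightarrow> int \<Rightarrow> pm \<Rightarrow> int \<Rightarrow> (pm \<times> int) free_alg set" where
  "normal_ord A a i b j =
    (if i < j then psi A a i \<otimes>\<^bsub>SF A\<^esub> psi A b j
     else if i > j then \<ominus>\<^bsub>SF A\<^esub> (psi A b j \<otimes>\<^bsub>SF A\<^esub> psi A a i)
     else scal A (1/2) \<otimes>\<^bsub>SF A\<^esub>
            (psi A a i \<otimes>\<^bsub>SF A\<^esub> psi A b j \<ominus>\<^bsub>SF A\<^esub> psi A b j \<otimes>\<^bsub>SF A\<^esub> psi A a i))"

section \<open>Modules\<close>

definition End_ring :: "(complex \<Rightarrow> 'v \<Rightarrow> 'v) \<Rightarrow> ('v::ab_group_add \<Rightarrow> 'v) ring" where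
  "End_ring smul =
    \<lparr>carrier = {f. Vector_Spaces.linear smul smul f},
     monoid.mult = (\<lambda>f g. f \<circ> g), one = id, zero = (\<lambda>_. 0), add = (\<lambda>f g v. f v + g v)\<rparr>"

definition SF_module ::
  "(int \<Rightarrow> complex^pm^pm) \<Rightarrow> (complex \<Rightarrow> 'v \<Rightarrow> 'v::ab_group_add) \<Rightarrow>
   ((pm \<times> int) free_alg set \<Rightarrow> 'v \<Rightarrow> 'v) \<Rightarrow> bool" where
  "SF_module A smul \<rho> \<longleftrightarrow>
    vector_space smul \<and> \<rho> \<in> ring_hom (SF A) (End_ring smul) \<and> (\<forall>c. \<rho> (scal A c) = smul c)"

definition smooth_SF_module ::
  "(int \<Rightarrow> complex^pm^pm) \<Rightarrow> (complex \<Rightarrow> 'v \<Rightarrow> 'v::ab_group_add) \<Rightarrow>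
   ((pm \<times> int) free_alg set \<Rightarrow> 'v \<Rightarrow> 'v) \<Rightarrow> bool" where
  "smooth_SF_module A smul \<rho> \<longleftrightarrow>
    SF_module A smul \<rho> \<and> (\<forall>v. \<exists>N. \<forall>n\<ge>N. \<forall>a. \<rho> (psi A a n) v = 0)"

section \<open>The Virasoro operators\<close>

text \<open>
  The sums over \<open>i + j = n\<close> run over all integers \<open>i\<close>, with \<open>j = n - i\<close>. They have finitely many
  nonzero terms for \<^const>\<open>sl2_connection\<close> and \<^const>\<open>smooth_SF_module\<close> (see \<open>finite_c_terms\<close>
  and \<open>finite_L_terms\<close>); \<^const>\<open>Sum_any\<close> adds up the nonzero terms.

  The term \<open>C\<^sup>+\<^sup>+ C\<^sup>-\<^sup>-\<close> has to enter the constant \<open>c\<^sub>n\<close> with a minus sign, so that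
  \<open>c(z) = -1/2 det C(z) = -1/2 det A(z) = 1/4 tr A(z)\<^sup>2\<close>, which is invariant under constant gauge
  transformations, as is \<open>\<Sum> :\<psi>\<^sup>-\<^sub>i \<psi>\<^sup>+\<^sub>j:\<close>. With a plus sign the Virasoro relations fail
  (see \<open>c0_forced\<close>).
\<close>

definition c_const :: "(int \<Rightarrow> complex^pm^pm) \<Rightarrow> int \<Rightarrow> complex" where
  "c_const A n = 1/2 * Sum_any (\<lambda>i.
      Cmat A i $ Minus $ Plus * Cmat A (n - i) $ Plus $ Minus
    - Cmat A i $ Plus $ Plus * Cmat A (n - i) $ Minus $ Minus)"

definition L_op ::
  "(int \<Rightarrow> complex^pm^pm) \<Rightarrow> (complex \<Rightarrow> 'v \<Rightarrow> 'v::ab_group_add) \<Rightarrow>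
   ((pm \<times> int) free_alg set \<Rightarrow> 'v \<Rightarrow> 'v) \<Rightarrow> int \<Rightarrow> 'v \<Rightarrow> 'v" where
  "L_op A smul \<rho> n v =
    Sum_any (\<lambda>i. \<rho> (normal_ord A Minus i Plus (n - i)) v) + smul (c_const A n) v"


section \<open>Basic facts\<close>

lemma ring_FA: "ring FA"
proof -
  have "\<exists>y. x + y = 0" for x :: "(pm \<times> int) free_alg"
    using add.right_inverse by blast
  then show ?thesis
    unfolding ring_of_type_algebra_def using add.right_inverse
    by unfold_locales (auto simp: algebra_simps Units_def)
qed

lemma FA_simps:
  "carrier FA = UNIV" "x \<otimes>\<^bsub>FA\<^esub> y = x * y" "x \<oplus>\<^bsub>FA\<^esub> y = x + y" "\<one>\<^bsub>FA\<^esub> = 1" "\<zero>\<^bsub>FA\<^esub> = 0"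
  by (auto simp: ring_of_type_algebra_def)

lemma SF_ideal: "ideal (SF_ideal A) FA"
  unfolding SF_ideal_def by (rule ring.genideal_ideal[OF ring_FA]) (simp add: FA_simps)

lemma SF_hom: "(\<lambda>x. SF_ideal A +>\<^bsub>FA\<^esub> x) \<in> ring_hom FA (SF A)"
  unfolding SF_def using ideal.rcos_ring_hom[OF SF_ideal] .

lemma ring_SF: "ring (SF A)"
  unfolding SF_def by (rule ideal.quotient_is_ring[OF SF_ideal])

lemma psi_closed: "psi A a n \<in> carrier (SF A)"
  unfolding psi_def using ring_hom_closed[OF SF_hom] by (simp add: FA_simps)

lemma scal_closed: "scal A c \<in> carrier (SF A)"
  unfolding scal_def using ring_hom_closed[OF SF_hom] by (simp add: FA_simps)

lemma SF_relation:
  "psi A a m \<otimes>\<^bsub>SF A\<^esub> psi A b n \<oplus>\<^bsub>SF A\<^esub> psi A b n \<otimes>\<^bsub>SF A\<^esub> psi A a m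
   = scal A ((if m + n = 0 then of_int m * omega a b else 0) + Cmat A (m + n) $ a $ b)"
    (is "_ = scal A ?c")
proof -
  let ?x = "gen (a, m) * gen (b, n) + gen (b, n) * gen (a, m)"
  let ?q = "\<lambda>x. SF_ideal A +>\<^bsub>FA\<^esub> x"
  have "?x - const ?c \<in> SF_relators A"
    unfolding SF_relators_def by blast
  then have "?x - const ?c \<in> SF_ideal A"
    unfolding SF_ideal_def using ring.genideal_self[OF ring_FA, of "SF_relators A"] by (auto simp: FA_simps)
  then have z: "?q (?x - const ?c) = \<zero>\<^bsub>SF A\<^esub>"
    using ring.a_rcos_zero[OF ring_FA SF_ideal] by (simp add: SF_def FactRing_def)
  have "?q ?x = ?q ((?x - const ?c) + const ?c)"
    by simp
  also have "\<dots> = ?q (?x - const ?c) \<oplus>\<^bsub>SF A\<^esub> ?q (const ?c)"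
    using ring_hom_add[OF SF_hom, of "?x - const ?c" "const ?c" A] by (simp add: FA_simps)
  also have "\<dots> = scal A ?c"
    using scal_closed[of A ?c] ring_SF[of A] z unfolding scal_def
    by (simp add: ring.ring_simprules)
  finally have "?q ?x = scal A ?c" .
  moreover have "?q ?x = psi A a m \<otimes>\<^bsub>SF A\<^esub> psi A b n \<oplus>\<^bsub>SF A\<^esub> psi A b n \<otimes>\<^bsub>SF A\<^esub> psi A a m"
    using ring_hom_add[OF SF_hom, of "gen (a, m) * gen (b, n)" "gen (b, n) * gen (a, m)" A]
      ring_hom_mult[OF SF_hom, of "gen (a, m)" "gen (b, n)" A]
      ring_hom_mult[OF SF_hom, of "gen (b, n)" "gen (a, m)" A]
    by (simp add: FA_simps psi_def)
  ultimately show ?thesis by simp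
qed


lemma Cmat_nth:
  "Cmat A k $ Plus $ b = - (A k $ Minus $ b)" "Cmat A k $ Minus $ b = A k $ Plus $ b"
proof -
  have U: "(UNIV :: pm set) = {Plus, Minus}"
    using pm.exhaust by blast
  show "Cmat A k $ Plus $ b = - (A k $ Minus $ b)" "Cmat A k $ Minus $ b = A k $ Plus $ b"
    by (simp_all add: Cmat_def Jmat_def matrix_matrix_mult_def U)
qed

lemma Cmat_sym:
  assumes "sl2_connection A"
  shows "Cmat A k $ a $ b = Cmat A k $ b $ a"
proof -
  have U: "(UNIV :: pm set) = {Plus, Minus}"
    using pm.exhaust by blast
  have "A k $ Plus $ Plus + A k $ Minus $ Minus = 0"
    using assms unfolding sl2_connection_def trace_def U by simp
  then show ?thesis
    by (cases a; cases b) (simp_all add: Cmat_nth add_eq_0_iff)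
qed

lemma finite_int_Collect:
  fixes P :: "int \<Rightarrow> bool"
  assumes "\<And>i. i > M \<Longrightarrow> \<not> P i" "\<And>i. n - i > M \<Longrightarrow> \<not> P i"
  shows "finite {i. P i}"
proof (rule finite_subset)
  show "{i. P i} \<subseteq> {n - M..M}"
    using assms by (auto simp: not_less[symmetric])
qed simp

lemma finite_c_terms:
  assumes "sl2_connection A"
  shows "finite {i. Cmat A i $ Minus $ Plus * Cmat A (n - i) $ Plus $ Minus
                  - Cmat A i $ Plus $ Plus * Cmat A (n - i) $ Minus $ Minus \<noteq> 0}"
proof -
  from assms obtain N where "\<And>k. k \<ge> N \<Longrightarrow> A k = 0"
    unfolding sl2_connection_def by blast
  then have C: "Cmat A k $ a $ b = 0" if "k \<ge> N" for k a b
    using that by (simp add: Cmat_def matrix_matrix_mult_def)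
  show ?thesis
    by (rule finite_int_Collect[of N _ n]) (auto simp: C)
qed

context
  fixes A and smul :: "complex \<Rightarrow> 'v \<Rightarrow> 'v::ab_group_add" and \<rho>
  assumes M: "SF_module A smul \<rho>"
begin

lemma rho_hom: "\<rho> \<in> ring_hom (SF A) (End_ring smul)"
  using M unfolding SF_module_def by simp

lemma rho_linear: "x \<in> carrier (SF A) \<Longrightarrow> Vector_Spaces.linear smul smul (\<rho> x)"
  using ring_hom_closed[OF rho_hom] by (simp add: End_ring_def)

lemma rho_0: "x \<in> carrier (SF A) \<Longrightarrow> \<rho> x 0 = 0"
  using Vector_Spaces.linear.axioms(3)[OF rho_linear, THEN module_hom.zero] by simp

lemma rho_mult: "x \<in> carrier (SF A) \<Longrightarrow> y \<in> carrier (SF A) \<Longrightarrow> \<rho> (x \<otimes>\<^bsub>SF A\<^esub> y) v = \<rho> x (\<rho> y v)"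
  using ring_hom_mult[OF rho_hom] by (simp add: End_ring_def)

lemma rho_add: "x \<in> carrier (SF A) \<Longrightarrow> y \<in> carrier (SF A) \<Longrightarrow> \<rho> (x \<oplus>\<^bsub>SF A\<^esub> y) v = \<rho> x v + \<rho> y v"
  using ring_hom_add[OF rho_hom] by (simp add: End_ring_def)

lemma rho_neg:
  assumes "x \<in> carrier (SF A)"
  shows "\<rho> (\<ominus>\<^bsub>SF A\<^esub> x) v = - \<rho> x v"
proof -
  interpret ring "SF A" by (rule ring_SF)
  have z: "\<rho> \<zero>\<^bsub>SF A\<^esub> v = 0"
    using rho_add[of "\<zero>\<^bsub>SF A\<^esub>" "\<zero>\<^bsub>SF A\<^esub>" v] by simp
  have "\<rho> x v + \<rho> (\<ominus>\<^bsub>SF A\<^esub> x) v = 0"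
    using rho_add[of x "\<ominus>\<^bsub>SF A\<^esub> x" v] assms z by (simp add: r_neg)
  then show ?thesis
    by (simp add: eq_neg_iff_add_eq_0 add.commute)
qed

lemma rho_scal: "\<rho> (scal A c) v = smul c v"
  using M unfolding SF_module_def by simp

lemma rho_psi_anticomm:
  "\<rho> (psi A a m) (\<rho> (psi A b n) v) + \<rho> (psi A b n) (\<rho> (psi A a m) v)
   = smul ((if m + n = 0 then of_int m * omega a b else 0) + Cmat A (m + n) $ a $ b) v"
  using arg_cong[OF SF_relation, of "\<lambda>x. \<rho> x v" A a m b n]
  by (simp add: rho_add rho_mult rho_scal psi_closed ring.ring_simprules ring_SF del: if_split)

lemma rho_normal_ord:
  "\<rho> (normal_ord A a i b j) v =
    (if i < j then \<rho> (psi A a i) (\<rho> (psi A b j) v)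
     else if i > j then - \<rho> (psi A b j) (\<rho> (psi A a i) v)
     else smul (1/2) (\<rho> (psi A a i) (\<rho> (psi A b j) v) - \<rho> (psi A b j) (\<rho> (psi A a i) v)))"
proof -
  interpret vector_space smul
    using M unfolding SF_module_def by blast
  show ?thesis
    by (simp add: normal_ord_def rho_add rho_mult rho_neg rho_scal psi_closed scal_closed
          a_minus_def ring.ring_simprules ring_SF scale_right_diff_distrib)
qed

end

lemma finite_L_terms:
  assumes "smooth_SF_module A smul \<rho>"
  shows "finite {i. \<rho> (normal_ord A Minus i Plus (n - i)) v \<noteq> 0}"
proof -
  have M: "SF_module A smul \<rho>"
    using assms unfolding smooth_SF_module_def by blast
  interpret vector_space smul
    using M unfolding SF_module_def by blast
  obtain N where N: "\<And>k a. k \<ge> N \<Longrightarrow> \<rho> (psi A a k) v = 0"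
    using assms unfolding smooth_SF_module_def by meson
  show ?thesis
    by (rule finite_int_Collect[of "max N \<bar>n\<bar>" _ n])
       (auto simp: rho_normal_ord[OF M] N rho_0[OF M] psi_closed)
qed

section \<open>The sign in \<open>c\<^sub>n\<close>\<close>

text \<open>
  For \<open>A(z) = A\<^sub>0 z\<^sup>-\<^sup>1\<close> and a vector \<open>v\<close> killed by all \<open>\<psi>\<^sub>n\<close> with \<open>n > 0\<close>, let \<open>T\<^sub>n\<close> be \<open>L\<^sub>n\<close>
  without the constant \<open>c\<^sub>n\<close>. Here \<open>c\<^sub>1 = c\<^sub>-\<^sub>1 = 0\<close>, so \<open>[L\<^sub>1, L\<^sub>-\<^sub>1] v = 2 L\<^sub>0 v\<close> says that
  \<open>[T\<^sub>1, T\<^sub>-\<^sub>1] v = 2 T\<^sub>0 v + 2 c\<^sub>0 v\<close>, which determines \<open>c\<^sub>0\<close>.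
\<close>

lemma c0_forced:
  fixes A and smul :: "complex \<Rightarrow> 'v \<Rightarrow> 'v::ab_group_add" and \<rho> and v
  defines "T \<equiv> \<lambda>n v. Sum_any (\<lambda>i. \<rho> (normal_ord A Minus i Plus (n - i)) v)"
  assumes A: "sl2_connection A" "\<And>k. k \<noteq> 0 \<Longrightarrow> A k = 0"
    and M: "SF_module A smul \<rho>"
    and v: "\<And>n a. n > 0 \<Longrightarrow> \<rho> (psi A a n) v = 0"
  shows "T 1 (T (- 1) v) - T (- 1) (T 1 v) = smul 2 (T 0 v)
    + smul (Cmat A 0 $ Minus $ Plus * Cmat A 0 $ Plus $ Minus
          - Cmat A 0 $ Plus $ Plus * Cmat A 0 $ Minus $ Minus) v"
proof -
  interpret vector_space smul
    using M unfolding SF_module_def by blast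
  define p where "p k = \<rho> (psi A Plus k)" for k
  define q where "q k = \<rho> (psi A Minus k)" for k
  define x where "x = Cmat A 0 $ Plus $ Plus"
  define y where "y = Cmat A 0 $ Minus $ Minus"
  define z where "z = Cmat A 0 $ Plus $ Minus"
  have z': "Cmat A 0 $ Minus $ Plus = z"
    unfolding z_def by (rule Cmat_sym[OF A(1)])
  have C0: "Cmat A k $ a $ b = 0" if "k \<noteq> 0" for k a b
    using A(2)[OF that] by (cases a) (simp_all add: Cmat_nth)
  have p0: "p k 0 = 0" and q0: "q k 0 = 0" for k
    by (simp_all add: p_def q_def rho_0[OF M] psi_closed)
  have lin: "module_hom smul smul (\<rho> (psi A a k))" for a k
    by (rule Vector_Spaces.linear.axioms(3)[OF rho_linear[OF M psi_closed]])
  have padd: "p k (u + w) = p k u + p k w" "q k (u + w) = q k u + q k w"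
    "p k (u - w) = p k u - p k w" "q k (u - w) = q k u - q k w"
    "p k (- u) = - p k u" "q k (- u) = - q k u"
    "p k (smul c u) = smul c (p k u)" "q k (smul c u) = smul c (q k u)" for k u w c
    by (simp_all add: p_def q_def module_hom.add[OF lin] module_hom.diff[OF lin] module_hom.neg[OF lin] module_hom.scale[OF lin])
  have vp: "p k v = 0" "q k v = 0" if "k > 0" for k
    using v[OF that] by (simp_all add: p_def q_def)
  note ac = rho_psi_anticomm[OF M, where a=Plus and b=Plus, folded p_def q_def]
            rho_psi_anticomm[OF M, where a=Minus and b=Minus, folded p_def q_def]
            rho_psi_anticomm[OF M, where a=Plus and b=Minus, folded p_def q_def]
            rho_psi_anticomm[OF M, where a=Minus and b=Plus, folded p_def q_def]
  have no: "\<rho> (normal_ord A Minus i Plus j) u =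
    (if i < j then q i (p j u) else if i > j then - p j (q i u)
     else smul (1/2) (q i (p j u) - p j (q i u)))" for i j u
    by (simp add: rho_normal_ord[OF M] p_def q_def)
  have T1: "T 1 v = 0"
  proof -
    have "\<rho> (normal_ord A Minus i Plus (1 - i)) v = 0" for i
      by (auto simp: no vp p0 q0)
    then show ?thesis unfolding T_def by simp
  qed
  have Tm: "T (- 1) v = q (- 1) (p 0 v) - p (- 1) (q 0 v)"
  proof -
    have "\<rho> (normal_ord A Minus i Plus (- 1 - i)) v = 0" if "i < -1 \<or> i > 0" for i
      using that by (auto simp: no vp p0 q0)
    then have "{i. \<rho> (normal_ord A Minus i Plus (- 1 - i)) v \<noteq> 0} \<subseteq> {-1, 0}"
      by (smt (verit) insertCI mem_Collect_eq subsetI)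
    then have "T (- 1) v = (\<Sum>i\<in>{-1, 0}. \<rho> (normal_ord A Minus i Plus (- 1 - i)) v)"
      unfolding T_def by (subst Sum_any.expand_superset[of "{-1, 0}"]) auto
    then show ?thesis by (simp add: no)
  qed
  have T0: "T 0 v = smul (1/2) (q 0 (p 0 v) - p 0 (q 0 v))"
  proof -
    have "\<rho> (normal_ord A Minus i Plus (0 - i)) v = 0" if "i < 0 \<or> i > 0" for i
      using that by (auto simp: no vp p0 q0)
    then have "{i. \<rho> (normal_ord A Minus i Plus (0 - i)) v \<noteq> 0} \<subseteq> {0}"
      by (smt (verit) insertCI mem_Collect_eq subsetI)
    then have "T 0 v = (\<Sum>i\<in>{0}. \<rho> (normal_ord A Minus i Plus (0 - i)) v)"
      unfolding T_def by (subst Sum_any.expand_superset[of "{0}"]) auto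
    then show ?thesis by (simp add: no)
  qed
  define w where "w = T (- 1) v"
  have anti: "p k (p l u) = smul (if k + l = 0 then x else 0) u - p l (p k u)"
    "q k (q l u) = smul (if k + l = 0 then y else 0) u - q l (q k u)"
    "p k (q l u) = smul (if k + l = 0 then of_int k + z else 0) u - q l (p k u)"
    "q k (p l u) = smul (if k + l = 0 then - of_int k + z else 0) u - p l (q k u)" for k l u
    using ac(1)[of k l u] ac(2)[of k l u] ac(3)[of k l u] ac(4)[of k l u]
    by (auto simp: eq_diff_eq x_def y_def z_def z' C0)
  have wk: "p k w = 0" "q k w = 0" if "k > 1" for k
    using that
    by (simp_all add: w_def Tm padd anti(1)[of k "-1"] anti(2)[of k "-1"] anti(3)[of k "-1"] anti(4)[of k "-1"]
       anti(1)[of k 0] anti(2)[of k 0] anti(3)[of k 0] anti(4)[of k 0] vp p0 q0)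
  have p1: "p 1 w = smul (1 + z) (p 0 v) - smul x (q 0 v)"
    by (simp add: w_def Tm padd anti(1)[of 1 "-1"] anti(3)[of 1 "-1"] anti(1)[of 1 0] anti(3)[of 1 0] vp p0 q0)
  have q1: "q 1 w = smul y (p 0 v) - smul (z - 1) (q 0 v)"
    by (simp add: w_def Tm padd anti(2)[of 1 "-1"] anti(4)[of 1 "-1"] anti(2)[of 1 0] anti(4)[of 1 0] vp p0 q0)
  have TT: "T 1 w = q 0 (p 1 w) - p 0 (q 1 w)"
  proof -
    have "\<rho> (normal_ord A Minus i Plus (1 - i)) w = 0" if "i < 0 \<or> i > 1" for i
      using that by (auto simp: no wk p0 q0)
    then have "{i. \<rho> (normal_ord A Minus i Plus (1 - i)) w \<noteq> 0} \<subseteq> {0, 1}"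
      by (smt (verit) insertCI mem_Collect_eq subsetI)
    then have "T 1 w = (\<Sum>i\<in>{0, 1}. \<rho> (normal_ord A Minus i Plus (1 - i)) w)"
      unfolding T_def by (subst Sum_any.expand_superset[of "{0, 1}"]) auto
    then show ?thesis by (simp add: no)
  qed
  have half: "p 0 (p 0 v) = smul (x / 2) v" "q 0 (q 0 v) = smul (y / 2) v"
  proof -
    have *: "a = smul (c / 2) v" if "a = smul c v - a" for a c
    proof -
      from that have "a + a = smul c v" by (simp add: eq_diff_eq)
      then have "smul 2 a = smul c v" using scale_left_distrib[of 1 1 a] by simp
      then have "smul (1/2) (smul 2 a) = smul (1/2) (smul c v)" by simp
      then show ?thesis by simp
    qed
    show "p 0 (p 0 v) = smul (x / 2) v" using anti(1)[of 0 0 v] by (intro *) simp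
    show "q 0 (q 0 v) = smul (y / 2) v" using anti(2)[of 0 0 v] by (intro *) simp
  qed
  have qp: "q 0 (p 0 v) = smul z v - p 0 (q 0 v)"
    using anti(4)[of 0 0 v] by simp
  have "T 1 w = smul 2 (T 0 v) + smul (z * z - x * y) v"
    unfolding TT p1 q1 T0 padd half qp by (simp add: algebra_simps)
       (simp add: scale_left_distrib[symmetric] algebra_simps)
  moreover have "\<rho> (normal_ord A Minus i Plus (- 1 - i)) 0 = 0" for i
    by (auto simp: no p0 q0)
  then have "T (- 1) 0 = 0"
    unfolding T_def by simp
  ultimately show ?thesis
    by (simp add: T1 w_def[symmetric] z' x_def[symmetric] y_def[symmetric] z_def[symmetric])
qed

end

theory Submission
  imports Defs
begin

text \<open>
  Up to the scalar \<open>(n + 1)/2 C\<^sub>n\<^sup>-\<^sup>+\<close>, the normally ordered sum equals the sum \<open>S\<^sub>n\<close> of the terms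
  \<open>\<psi>\<^sup>-\<^sub>i \<psi>\<^sup>+\<^sub>n\<^sub>-\<^sub>i\<close> for \<open>i < 0\<close> and \<open>- \<psi>\<^sup>+\<^sub>n\<^sub>-\<^sub>i \<psi>\<^sup>-\<^sub>i\<close> for \<open>i \<ge> 0\<close>. Since this ordering depends on the
  index \<open>i\<close> only, all sums that arise by applying the derivation \<open>[S\<^sub>m, -]\<close> to the terms of \<open>S\<^sub>n\<close>
  are separately finite on each vector, so no regularization is needed. One has
  \<open>[S\<^sub>m, \<psi>\<^sup>a\<^sub>k] = - k \<psi>\<^sup>a\<^sub>m\<^sub>+\<^sub>k + R\<^sup>a\<^sub>m\<^sub>+\<^sub>k\<close>, where \<open>R\<close> is linear in \<open>C\<close> and in \<open>\<psi>\<close>. The part with the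
  factors \<open>- k\<close> gives \<open>(m - n) S\<^sub>m\<^sub>+\<^sub>n\<close> and, from finitely many reordered terms, the cubic cocycle. In
  the part with \<open>R\<close> the coefficients of \<open>\<psi>\<^sup>-\<psi>\<^sup>+\<close> and \<open>\<psi>\<^sup>+\<psi>\<^sup>-\<close> agree and those of \<open>\<psi>\<^sup>\<plusminus>\<psi>\<^sup>\<plusminus>\<close> are
  symmetric, so that only anticommutators survive and the sum is a scalar.
\<close>

section \<open>Sums with finite support\<close>

lemma finite_between_int:
  fixes P :: "int \<Rightarrow> bool"
  assumes "\<And>i. P i \<Longrightarrow> lo \<le> i \<and> i \<le> hi"
  shows "finite {i. P i}"
  by (rule finite_subset[of _ "{lo..hi}"]) (use assms in auto)

lemma finite_support_add:
  fixes f g :: "'i \<Rightarrow> 'a::monoid_add"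
  assumes "finite {i. f i \<noteq> 0}" "finite {i. g i \<noteq> 0}"
  shows "finite {i. f i + g i \<noteq> 0}"
  by (rule finite_subset[of _ "{i. f i \<noteq> 0} \<union> {i. g i \<noteq> 0}"]) (use assms in auto)

lemma finite_support_diff:
  fixes f g :: "'i \<Rightarrow> 'a::group_add"
  assumes "finite {i. f i \<noteq> 0}" "finite {i. g i \<noteq> 0}"
  shows "finite {i. f i - g i \<noteq> 0}"
  by (rule finite_subset[of _ "{i. f i \<noteq> 0} \<union> {i. g i \<noteq> 0}"]) (use assms in auto)

lemma finite_support_reindex:
  assumes "bij l" "finite {i. f i \<noteq> 0}"
  shows "finite {i. f (l i) \<noteq> 0}"
  using finite_vimageI[OF assms(2) bij_is_inj[OF assms(1)]] by (simp add: vimage_def)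

text \<open>\<open>Sum_any\<close> returns 0 when infinitely many terms are nonzero, so
  \<open>h\<close> passes through it only for finite support; \<open>h 0 = 0\<close> keeps the
  support of the images inside that of \<open>f\<close>. For the same reason each rearrangement
  below comes with a finiteness fact.\<close>

lemma Sum_any_additive:
  fixes h :: "'a::ab_group_add \<Rightarrow> 'b::ab_group_add"
  assumes h: "\<And>x y. h (x + y) = h x + h y" and fin: "finite {i. f i \<noteq> 0}"
  shows "h (Sum_any f) = Sum_any (\<lambda>i. h (f i))"
proof -
  interpret additive h by unfold_locales (rule h)
  have "{i. h (f i) \<noteq> 0} \<subseteq> {i. f i \<noteq> 0}"
    by (auto simp: zero)
  then show ?thesis
    using fin by (simp add: Sum_any.expand_superset[of "{i. f i \<noteq> 0}"] sum)
qed

lemma Sum_any_diff: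
  fixes f g :: "'i \<Rightarrow> 'a::ab_group_add"
  assumes "finite {i. f i \<noteq> 0}" "finite {i. g i \<noteq> 0}"
  shows "Sum_any (\<lambda>i. f i - g i) = Sum_any f - Sum_any g"
proof -
  have "Sum_any f = Sum_any (\<lambda>i. (f i - g i) + g i)"
    by simp
  also have "\<dots> = Sum_any (\<lambda>i. f i - g i) + Sum_any g"
    by (rule Sum_any.distrib[OF finite_support_diff[OF assms] assms(2)])
  finally show ?thesis by simp
qed

text \<open>Fubini for finite support: the two projections of the support span a finite rectangle
  that contains it.\<close>

lemma Sum_any_pairs:
  fixes f :: "'i \<times> 'j \<Rightarrow> 'a::comm_monoid_add"
  assumes "finite {p. f p \<noteq> 0}"
  shows "Sum_any (\<lambda>i. Sum_any (\<lambda>j. f (i, j))) = Sum_any f"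
proof -
  let ?S = "{p. f p \<noteq> 0}"
  have "{i. \<exists>j. f (i, j) \<noteq> 0} \<times> {j. \<exists>i. f (i, j) \<noteq> 0} \<subseteq> fst ` ?S \<times> snd ` ?S"
    by force
  from Sum_any.cartesian_product[OF _ this] assms show ?thesis
    by simp
qed

lemma bij_int_shift: "bij (\<lambda>k::int. k + c)" "bij (\<lambda>k::int. c - k)"
proof -
  show "bij (\<lambda>k::int. k + c)" by (rule bij_betw_byWitness[where f' = "\<lambda>k. k - c"]) auto
  show "bij (\<lambda>k::int. c - k)" by (rule bij_betw_byWitness[where f' = "\<lambda>k. c - k"]) auto
qed

lemma bij_swap: "bij prod.swap"
  by (rule bij_betw_byWitness[where f' = "prod.swap"]) auto

lemma Sum_any_pairs_swap:
  fixes f :: "'i \<times> 'j \<Rightarrow> 'a::comm_monoid_add"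
  assumes "finite {p. f p \<noteq> 0}"
  shows "Sum_any (\<lambda>j. Sum_any (\<lambda>i. f (i, j))) = Sum_any f"
proof -
  have "Sum_any (\<lambda>j. Sum_any (\<lambda>i. f (i, j))) = Sum_any (f \<circ> prod.swap)"
    using finite_support_reindex[OF bij_swap, where f = f] assms
    by (subst Sum_any_pairs[symmetric]) simp_all
  also have "\<dots> = Sum_any f"
    by (rule Sum_any.reindex_cong[OF bij_swap refl, symmetric])
  finally show ?thesis .
qed

lemma finite_support_iterated:
  fixes f :: "'i \<times> 'j \<Rightarrow> 'a::comm_monoid_add"
  assumes "finite {p. f p \<noteq> 0}"
  shows "finite {i. Sum_any (\<lambda>j. f (i, j)) \<noteq> 0}" "finite {j. Sum_any (\<lambda>i. f (i, j)) \<noteq> 0}"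
proof -
  have "{i. Sum_any (\<lambda>j. f (i, j)) \<noteq> 0} \<subseteq> fst ` {p. f p \<noteq> 0}"
    by (auto elim!: Sum_any.not_neutral_obtains_not_neutral simp: image_iff)
  then show "finite {i. Sum_any (\<lambda>j. f (i, j)) \<noteq> 0}"
    by (rule finite_subset) (use assms in simp)
  have "{j. Sum_any (\<lambda>i. f (i, j)) \<noteq> 0} \<subseteq> snd ` {p. f p \<noteq> 0}"
    by (auto elim!: Sum_any.not_neutral_obtains_not_neutral simp: image_iff)
  then show "finite {j. Sum_any (\<lambda>i. f (i, j)) \<noteq> 0}"
    by (rule finite_subset) (use assms in simp)
qed

section \<open>Signed intervals and signed quadrants\<close>

lemma Sum_any_telescope_aux:
  fixes F :: "int \<Rightarrow> complex"
  assumes "a \<le> b"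
  shows "(\<Sum>i\<in>{a..<b}. F (i + 1) - F i) = F b - F a"
  using assms
proof (induction rule: int_ge_induct)
  case (step i)
  then have "{a..<i + 1} = insert i {a..<i}" by auto
  with step show ?case by simp
qed simp

lemma of_bool_diff_support:
  fixes a b :: int
  shows "{i. (of_bool (i < b) - of_bool (i < a)) * (f i :: complex) \<noteq> 0} \<subseteq> {min a b..<max a b}"
  by auto

text \<open>With signed intervals the closed formulas below hold for all integers, without a case
  distinction on the signs of the mode numbers.\<close>

lemma Sum_any_telescope:
  fixes F :: "int \<Rightarrow> complex"
  assumes "\<And>i. F (i + 1) - F i = f i"
  shows "Sum_any (\<lambda>i. (of_bool (i < b) - of_bool (i < a)) * f i) = F b - F a"
proof (cases "a \<le> b")
  case True
  have "Sum_any (\<lambda>i. (of_bool (i < b) - of_bool (i < a)) * f i) = (\<Sum>i\<in>{a..<b}. F (i + 1) - F i)"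
    using True of_bool_diff_support[of b a f]
    by (subst Sum_any.expand_superset[of "{a..<b}"]) (auto simp: assms intro!: sum.cong)
  then show ?thesis
    using Sum_any_telescope_aux[OF True, of F] by simp
next
  case False
  have "Sum_any (\<lambda>i. (of_bool (i < b) - of_bool (i < a)) * f i) = (\<Sum>i\<in>{b..<a}. - (F (i + 1) - F i))"
    using False of_bool_diff_support[of b a f]
    by (subst Sum_any.expand_superset[of "{b..<a}"]) (auto simp: assms intro!: sum.cong)
  then show ?thesis
    using Sum_any_telescope_aux[of b a F] False by (simp only: sum_negf) simp
qed

lemma bij_antidiagonal: "bij (\<lambda>(s, j). (s - j, j :: int))"
  by (rule bij_betw_byWitness[where f' = "\<lambda>(i, j). (i + j, j)"]) auto

text \<open>The weight is 1 on the quadrant \<open>i > t\<close>, \<open>j > n\<close>, is -1 on the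
  opposite quadrant \<open>i \<le> t\<close>, \<open>j \<le> n\<close>, and vanishes elsewhere. Each
  antidiagonal \<open>i + j = s\<close> meets it in a finite signed interval, whose length is the
  new weight of \<open>f s\<close>.\<close>

lemma Sum_any_quadrants:
  fixes f :: "int \<Rightarrow> complex"
  assumes fin: "finite {s. f s \<noteq> 0}"
  shows "finite {(i, j). (of_bool (j > n) - of_bool (i \<le> t)) * f (i + j) \<noteq> 0}"
    and "Sum_any (\<lambda>(i, j). (of_bool (j > n) - of_bool (i \<le> t)) * f (i + j))
         = Sum_any (\<lambda>s. of_int (s - n - t - 1) * f s)"
proof -
  let ?g = "\<lambda>(i, j). (of_bool (j > n) - of_bool (i \<le> t)) * f (i + j)"
  \<comment> \<open>With \<open>i = s - j\<close>, the condition \<open>i \<le> t\<close> becomes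
    \<open>j \<ge> s - t\<close>; passing to complements turns the weight into the signed interval
    from \<open>n + 1\<close> to \<open>s - t\<close>.\<close>
  let ?h = "\<lambda>(s, j). (of_bool (j < s - t) - of_bool (j < n + 1)) * f s"
  have gh: "?g \<circ> (\<lambda>(s, j). (s - j, j)) = ?h"
    by (auto simp: fun_eq_iff)
  have "{p. ?h p \<noteq> 0} \<subseteq> (SIGMA s:{s. f s \<noteq> 0}. {min (n + 1) (s - t)..<max (n + 1) (s - t)})"
    by (auto simp: of_bool_def split: if_splits)
  then have finh: "finite {p. ?h p \<noteq> 0}"
    by (rule finite_subset) (use fin in auto)
  have "bij (\<lambda>(i, j). (i + j, j :: int))"
    by (rule bij_betw_byWitness[where f' = "\<lambda>(s, j). (s - j, j)"]) auto
  from finite_support_reindex[OF this finh] have "finite {p. ?h (case p of (i, j) \<Rightarrow> (i + j, j)) \<noteq> 0}" .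
  moreover have "?h (case p of (i, j) \<Rightarrow> (i + j, j)) = ?g p" for p
    by (cases p) auto
  ultimately have "finite {p. ?g p \<noteq> 0}"
    by (simp only:)
  then show "finite {(i, j). (of_bool (j > n) - of_bool (i \<le> t)) * f (i + j) \<noteq> 0}"
    unfolding case_prod_beta' .
  have "Sum_any ?g = Sum_any ?h"
    by (rule Sum_any.reindex_cong[OF bij_antidiagonal gh])
  also have "\<dots> = Sum_any (\<lambda>s. Sum_any (\<lambda>j. (of_bool (j < s - t) - of_bool (j < n + 1)) * f s))"
    by (subst Sum_any_pairs[OF finh, symmetric]) simp
  also have "\<dots> = Sum_any (\<lambda>s. of_int (s - n - t - 1) * f s)"
  proof (rule Sum_any.cong)
    fix s
    show "Sum_any (\<lambda>j. (of_bool (j < s - t) - of_bool (j < n + 1)) * f s) = of_int (s - n - t - 1) * f s"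
      by (subst Sum_any_telescope[where F = "\<lambda>j. of_int j * f s"]) (auto simp: algebra_simps)
  qed
  finally show "Sum_any ?g = Sum_any (\<lambda>s. of_int (s - n - t - 1) * f s)" .
qed

section \<open>Smooth families of fermionic modes\<close>

text \<open>Only the modes as operators on vectors enter the computation, so the quotient algebra is
  replaced by their linearity, anticommutators and smoothness, together with the symmetry of
  \<open>C\<close> and its vanishing for large index.\<close>

locale smooth_modes = vector_space smul
  for smul :: "complex \<Rightarrow> 'v \<Rightarrow> 'v::ab_group_add" +
  fixes \<psi> :: "pm \<Rightarrow> int \<Rightarrow> 'v \<Rightarrow> 'v" and C :: "int \<Rightarrow> pm \<Rightarrow> pm \<Rightarrow> complex"
  assumes psi_add: "\<psi> a k (u + w) = \<psi> a k u + \<psi> a k w"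
    and psi_scale: "\<psi> a k (smul c u) = smul c (\<psi> a k u)"
    and anticomm: "\<psi> a k (\<psi> b l u) + \<psi> b l (\<psi> a k u)
      = smul ((if k + l = 0 then of_int k * omega a b else 0) + C (k + l) a b) u"
    and smooth: "\<exists>N. \<forall>n\<ge>N. \<forall>a. \<psi> a n u = 0"
    and C_sym: "C k a b = C k b a"
    and C_bound: "\<exists>N. \<forall>k\<ge>N. \<forall>a b. C k a b = 0"
begin

definition \<kappa> :: "pm \<Rightarrow> pm \<Rightarrow> int \<Rightarrow> int \<Rightarrow> complex" where
  "\<kappa> a b k l = (if k + l = 0 then of_int k * omega a b else 0) + C (k + l) a b"

lemma anticomm': "\<psi> a k (\<psi> b l u) + \<psi> b l (\<psi> a k u) = smul (\<kappa> a b k l) u"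
  unfolding \<kappa>_def by (rule anticomm)

sublocale psi: additive "\<psi> a k" for a k
  by unfold_locales (rule psi_add)

definition ord_term :: "int \<Rightarrow> int \<Rightarrow> 'v \<Rightarrow> 'v" where
  "ord_term n i u = (if i < 0 then \<psi> Minus i (\<psi> Plus (n - i) u) else - \<psi> Plus (n - i) (\<psi> Minus i u))"

definition S :: "int \<Rightarrow> 'v \<Rightarrow> 'v" where
  "S n u = Sum_any (\<lambda>i. ord_term n i u)"

text \<open>The effect of the connection on the commutator of \<open>S m\<close> with a mode
  \<open>\<psi> a k\<close>; it depends on \<open>m\<close> and \<open>k\<close> only through
  \<open>N = m + k\<close>.\<close>

definition R :: "pm \<Rightarrow> int \<Rightarrow> 'v \<Rightarrow> 'v" where
  "R a N u = Sum_any (\<lambda>j. smul (C (N - j) a Plus) (\<psi> Minus j u) - smul (C (N - j) a Minus) (\<psi> Plus j u))"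

text \<open>Composing \<open>R\<close> with a further mode leaves two free mode numbers, tied only
  through the argument of \<open>C\<close>; hence double sums with a general weight.\<close>

definition D :: "pm \<Rightarrow> pm \<Rightarrow> (int \<Rightarrow> int \<Rightarrow> complex) \<Rightarrow> 'v \<Rightarrow> 'v" where
  "D a b w v = Sum_any (\<lambda>(i, j). smul (w i j) (\<psi> a i (\<psi> b j v)))"

lemma cutoff:
  obtains K where "\<And>u a n. n \<ge> K u \<Longrightarrow> \<psi> a n u = 0"
  using smooth by metis

lemma finite_ord_terms: "finite {i. ord_term n i u \<noteq> 0}"
proof -
  obtain K where K: "\<And>u a n. n \<ge> K u \<Longrightarrow> \<psi> a n u = 0" using cutoff by blast
  show ?thesis
  proof (rule finite_between_int)
    fix i assume "ord_term n i u \<noteq> 0"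
    then show "min 0 (n - K u) \<le> i \<and> i \<le> max 0 (K u)"
      by (rule contrapos_np) (auto simp: ord_term_def K psi.zero)
  qed
qed

lemma finite_C_terms: "finite {j. smul (C (N - j) a b) (\<psi> c j u) \<noteq> 0}"
proof -
  obtain K where K: "\<And>u a n. n \<ge> K u \<Longrightarrow> \<psi> a n u = 0" using cutoff by blast
  obtain L where L: "\<And>k a b. k \<ge> L \<Longrightarrow> C k a b = 0" using C_bound by blast
  show ?thesis
  proof (rule finite_between_int)
    fix j assume "smul (C (N - j) a b) (\<psi> c j u) \<noteq> 0"
    then show "N - L \<le> j \<and> j \<le> K u"
      by (rule contrapos_np) (auto simp: K L)
  qed
qed

lemma S_add: "S n (u + w) = S n u + S n w"
proof -
  have "ord_term n i (u + w) = ord_term n i u + ord_term n i w" for i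
    by (simp add: ord_term_def psi_add)
  then show ?thesis
    by (simp add: S_def Sum_any.distrib finite_ord_terms)
qed

sublocale S: additive "S n" for n
  by unfold_locales (rule S_add)

lemma S_scale: "S n (smul c u) = smul c (S n u)"
proof -
  have "ord_term n i (smul c u) = smul c (ord_term n i u)" for i
    by (simp add: ord_term_def psi_scale)
  then show ?thesis
    unfolding S_def
    by (subst Sum_any_additive[where h = "smul c"]) (simp_all add: scale_right_distrib finite_ord_terms)
qed

lemma R_split: "R a N u = Sum_any (\<lambda>j. smul (C (N - j) a Plus) (\<psi> Minus j u))
    - Sum_any (\<lambda>j. smul (C (N - j) a Minus) (\<psi> Plus j u))"
  unfolding R_def by (rule Sum_any_diff[OF finite_C_terms finite_C_terms])

section \<open>Commutator with a single mode\<close>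

text \<open>This is \<open>[xy, z] = x{y, z} - {x, z}y\<close>. The two orders in
  \<open>ord_term\<close> differ by a scalar, so the result does not depend on the sign of
  \<open>i\<close>.\<close>

lemma ord_term_comm:
  "ord_term m i (\<psi> a k u) - \<psi> a k (ord_term m i u)
   = smul (\<kappa> Plus a (m - i) k) (\<psi> Minus i u) - smul (\<kappa> Minus a i k) (\<psi> Plus (m - i) u)"
proof -
  have q: "\<psi> Minus i (\<psi> a k w) = smul (\<kappa> Minus a i k) w - \<psi> a k (\<psi> Minus i w)" for w
    using anticomm'[of Minus i a k w] by (simp add: eq_diff_eq)
  have p: "\<psi> Plus (m - i) (\<psi> a k w) = smul (\<kappa> Plus a (m - i) k) w - \<psi> a k (\<psi> Plus (m - i) w)" for w
    using anticomm'[of Plus "m - i" a k w] by (simp add: eq_diff_eq)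
  show ?thesis
    by (simp add: ord_term_def p q psi.diff psi.minus psi_scale)
qed

lemma S_comm: "S m (\<psi> a k u) - \<psi> a k (S m u) = smul (- of_int k) (\<psi> a (m + k) u) + R a (m + k) u"
proof -
  have *: "Sum_any (\<lambda>i. smul (\<kappa> Plus a (m - i) k) (\<psi> Minus i u))
     = smul (- of_int k * omega Plus a) (\<psi> Minus (m + k) u)
       + Sum_any (\<lambda>j. smul (C (m + k - j) a Plus) (\<psi> Minus j u))"
    (is "Sum_any ?f = ?d + Sum_any ?g")
    and f: "finite {i. smul (\<kappa> Plus a (m - i) k) (\<psi> Minus i u) \<noteq> 0}"
  proof -
    \<comment> \<open>The central term of \<open>\<kappa>\<close> requires
      \<open>m - i = - k\<close>, that is the single index \<open>i = m + k\<close>;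
      \<open>?g\<close> is the connection part.\<close>
    let ?h = "\<lambda>i. if i = m + k then ?d else 0"
    have eq: "?f i = ?h i + ?g i" for i
      by (auto simp: \<kappa>_def scale_left_distrib C_sym[of _ Plus a] algebra_simps)
    have h: "finite {i. ?h i \<noteq> 0}"
      by (rule finite_subset[of _ "{m + k}"]) auto
    show "Sum_any ?f = ?d + Sum_any ?g"
      unfolding eq by (subst Sum_any.distrib[OF h finite_C_terms]) simp
    show "finite {i. ?f i \<noteq> 0}"
      unfolding eq by (rule finite_support_add[OF h finite_C_terms])
  qed
  have **: "Sum_any (\<lambda>i. smul (\<kappa> Minus a i k) (\<psi> Plus (m - i) u))
     = smul (- of_int k * omega Minus a) (\<psi> Plus (m + k) u)
       + Sum_any (\<lambda>j. smul (C (m + k - j) a Minus) (\<psi> Plus j u))"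
    (is "Sum_any ?f = ?d + Sum_any ?g")
    and g: "finite {i. smul (\<kappa> Minus a i k) (\<psi> Plus (m - i) u) \<noteq> 0}"
  proof -
    \<comment> \<open>Here the central term sits at \<open>i = - k\<close>, and the summation index
      of \<open>R\<close> is \<open>j = m - i\<close>.\<close>
    let ?h = "\<lambda>i. if i = - k then ?d else 0"
    have eq: "?f i = ?h i + ?g (m - i)" for i
    proof -
      have "- k + k = (0::int)" by simp
      moreover have "i + k = 0 \<longleftrightarrow> i = - k" by auto
      ultimately show ?thesis
        by (auto simp: \<kappa>_def scale_left_distrib C_sym[of _ Minus a] algebra_simps)
    qed
    have h: "finite {i. ?h i \<noteq> 0}"
      by (rule finite_subset[of _ "{- k}"]) auto
    have fg: "finite {i. ?g (m - i) \<noteq> 0}"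
      by (rule finite_support_reindex[OF bij_int_shift(2) finite_C_terms])
    have "Sum_any (\<lambda>i. ?g (m - i)) = Sum_any ?g"
      by (rule Sum_any.reindex_cong[OF bij_int_shift(2)[of m], symmetric]) (simp add: fun_eq_iff)
    then show "Sum_any ?f = ?d + Sum_any ?g"
      unfolding eq by (subst Sum_any.distrib[OF h fg]) simp
    show "finite {i. ?f i \<noteq> 0}"
      unfolding eq by (rule finite_support_add[OF h fg])
  qed
  have fin: "finite {i. \<psi> a k (ord_term m i u) \<noteq> 0}"
    by (rule finite_subset[OF _ finite_ord_terms[of m u]]) (auto simp: psi.zero)
  have "S m (\<psi> a k u) - \<psi> a k (S m u) = Sum_any (\<lambda>i. ord_term m i (\<psi> a k u) - \<psi> a k (ord_term m i u))"
    unfolding S_def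
    by (subst Sum_any_additive[of "\<psi> a k"]) (simp_all add: psi_add finite_ord_terms Sum_any_diff fin)
  also have "\<dots> = smul (- of_int k * omega Plus a) (\<psi> Minus (m + k) u)
     - smul (- of_int k * omega Minus a) (\<psi> Plus (m + k) u) + R a (m + k) u"
    unfolding ord_term_comm R_split by (subst Sum_any_diff[OF f g]) (simp add: * **)
  \<comment> \<open>One of \<open>omega Plus a\<close> and \<open>omega Minus a\<close> is 0; the
    other one combines with the sign in front of its term to 1, so both values of \<open>a\<close>
    give the factor \<open>- k\<close>.\<close>
  also have "\<dots> = smul (- of_int k) (\<psi> a (m + k) u) + R a (m + k) u"
    by (cases a) simp_all
  finally show ?thesis .
qed

section \<open>Double sums of products of two modes\<close>

text \<open>Smoothness at \<open>v\<close> bounds \<open>j\<close> above; for each of the finitely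
  many remaining \<open>j\<close>, smoothness at \<open>\<psi> b j v\<close> bounds \<open>i\<close>
  above, and \<open>i + j \<ge> c\<close> bounds it below.\<close>

lemma finite_D_terms:
  assumes "\<And>i j. w i j \<noteq> 0 \<Longrightarrow> j \<ge> c \<and> i + j \<ge> c"
  shows "finite {p. (case p of (i, j) \<Rightarrow> smul (w i j) (\<psi> a i (\<psi> b j v))) \<noteq> 0}"
proof -
  obtain K where K: "\<And>u a n. n \<ge> K u \<Longrightarrow> \<psi> a n u = 0" using cutoff by blast
  let ?B = "\<Union>j\<in>{c..K v}. {c - j..K (\<psi> b j v)} \<times> {j}"
  have "(i, j) \<in> ?B" if nz: "smul (w i j) (\<psi> a i (\<psi> b j v)) \<noteq> 0" for i j
  proof -
    have "w i j \<noteq> 0" using nz by auto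
    moreover have "i \<le> K (\<psi> b j v)"
      using nz by (rule contrapos_np) (simp add: K)
    moreover have "j \<le> K v"
      using nz by (rule contrapos_np) (simp add: K psi.zero)
    ultimately show ?thesis using assms[of i j] by auto
  qed
  then have "{p. (case p of (i, j) \<Rightarrow> smul (w i j) (\<psi> a i (\<psi> b j v))) \<noteq> 0} \<subseteq> ?B"
    by auto
  then show ?thesis
    by (rule finite_subset) auto
qed

lemma D_diff:
  assumes "\<And>i j. w i j \<noteq> 0 \<Longrightarrow> j \<ge> c \<and> i + j \<ge> c" "\<And>i j. w' i j \<noteq> 0 \<Longrightarrow> j \<ge> c' \<and> i + j \<ge> c'"
  shows "D a b w v - D a b w' v = D a b (\<lambda>i j. w i j - w' i j) v"
  unfolding D_def
  by (subst Sum_any_diff[OF finite_D_terms[OF assms(1)] finite_D_terms[OF assms(2)], symmetric])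
    (auto simp: scale_left_diff_distrib case_prod_beta')

text \<open>Matching the pair \<open>(i, j)\<close> with its swap leaves one anticommutator, a
  scalar. Lower bounds on both indices are required, since after the swap \<open>i\<close> is the
  index of the mode that acts first.\<close>

lemma D_anticomm:
  assumes "\<And>i j. w i j \<noteq> 0 \<Longrightarrow> i \<ge> c \<and> j \<ge> c \<and> i + j \<ge> c"
    and "finite {(i, j). w i j * \<kappa> a b i j \<noteq> 0}"
  shows "D a b w v + D b a (\<lambda>j i. w i j) v = smul (Sum_any (\<lambda>(i, j). w i j * \<kappa> a b i j)) v"
proof -
  let ?f = "\<lambda>(i, j). smul (w i j) (\<psi> a i (\<psi> b j v))"
  let ?g = "\<lambda>(j, i). smul (w i j) (\<psi> b j (\<psi> a i v))"
  let ?k = "\<lambda>(i, j). w i j * \<kappa> a b i j"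
  have f: "finite {p. ?f p \<noteq> 0}"
    by (rule finite_D_terms[where c = c]) (use assms(1) in auto)
  have g: "finite {p. ?g p \<noteq> 0}"
    by (rule finite_D_terms[where c = c]) (use assms(1) in \<open>force simp: add.commute\<close>)
  have eq: "?f p + ?g (prod.swap p) = smul (?k p) v" for p
    by (cases p) (simp flip: scale_right_distrib add: anticomm')
  have "D a b w v + D b a (\<lambda>j i. w i j) v = Sum_any ?f + Sum_any (\<lambda>p. ?g (prod.swap p))"
    unfolding D_def by (subst Sum_any.reindex_cong[OF bij_swap refl, of ?g]) (simp add: comp_def)
  also have "\<dots> = Sum_any (\<lambda>p. smul (?k p) v)"
    by (subst Sum_any.distrib[OF f finite_support_reindex[OF bij_swap g], symmetric]) (simp only: eq)
  also have "\<dots> = smul (Sum_any ?k) v"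
    using assms(2)
    by (subst Sum_any_additive[where h = "\<lambda>c. smul c v"]) (auto simp: scale_left_distrib case_prod_beta')
  finally show ?thesis .
qed

section \<open>The connection part of the commutator\<close>

text \<open>Here \<open>j = l\<close> is bounded below by the support of \<open>h\<close>, and
  \<open>i + j\<close> by the vanishing of \<open>C\<close> for large index, so the double sum may
  be taken in either order.\<close>

lemma outer_correction:
  assumes h: "\<And>l. h l \<noteq> 0 \<Longrightarrow> l \<ge> c"
  shows "finite {l. smul (h l) (R a (M - l) (\<psi> b l v)) \<noteq> 0}"
    and "Sum_any (\<lambda>l. smul (h l) (R a (M - l) (\<psi> b l v)))
      = D Minus b (\<lambda>i j. h j * C (M - i - j) a Plus) v - D Plus b (\<lambda>i j. h j * C (M - i - j) a Minus) v"
proof -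
  obtain L where L: "\<And>k a b. k \<ge> L \<Longrightarrow> C k a b = 0" using C_bound by blast
  let ?f = "\<lambda>d e (i, j). smul (h j * C (M - i - j) a d) (\<psi> e i (\<psi> b j v))"
  let ?F = "\<lambda>p. ?f Plus Minus p - ?f Minus Plus p"
  have fin: "finite {p. ?f d e p \<noteq> 0}" for d e
  proof (rule finite_D_terms)
    fix i j assume "h j * C (M - i - j) a d \<noteq> 0"
    then have "h j \<noteq> 0" "\<not> M - i - j \<ge> L" using L by auto
    then show "j \<ge> min c (M - L) \<and> i + j \<ge> min c (M - L)" using h[of j] by auto
  qed
  have F: "finite {p. ?F p \<noteq> 0}"
    by (rule finite_support_diff[OF fin fin])
  have sum_eq: "smul (h l) (R a (M - l) (\<psi> b l v)) = Sum_any (\<lambda>i. ?F (i, l))" for l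
    unfolding R_def
    by (subst Sum_any_additive[where h = "smul (h l)", OF _ finite_support_diff[OF finite_C_terms finite_C_terms]])
      (auto simp: scale_right_distrib scale_right_diff_distrib algebra_simps)
  show "finite {l. smul (h l) (R a (M - l) (\<psi> b l v)) \<noteq> 0}"
    unfolding sum_eq by (rule finite_support_iterated(2)[OF F])
  have "Sum_any (\<lambda>l. smul (h l) (R a (M - l) (\<psi> b l v))) = Sum_any ?F"
    unfolding sum_eq by (rule Sum_any_pairs_swap[OF F])
  then show "Sum_any (\<lambda>l. smul (h l) (R a (M - l) (\<psi> b l v)))
      = D Minus b (\<lambda>i j. h j * C (M - i - j) a Plus) v - D Plus b (\<lambda>i j. h j * C (M - i - j) a Minus) v"
    unfolding D_def by (simp only: Sum_any_diff[OF fin fin])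
qed

text \<open>Now \<open>i = l\<close> is bounded above; together with the lower bound for
  \<open>i + j\<close> coming from \<open>C\<close> this bounds \<open>j\<close> below.\<close>

lemma inner_correction:
  assumes h: "\<And>l. h l \<noteq> 0 \<Longrightarrow> l \<le> c"
  shows "finite {l. smul (h l) (\<psi> b l (R a (M - l) v)) \<noteq> 0}"
    and "Sum_any (\<lambda>l. smul (h l) (\<psi> b l (R a (M - l) v)))
      = D b Minus (\<lambda>i j. h i * C (M - i - j) a Plus) v - D b Plus (\<lambda>i j. h i * C (M - i - j) a Minus) v"
proof -
  obtain L where L: "\<And>k a b. k \<ge> L \<Longrightarrow> C k a b = 0" using C_bound by blast
  let ?f = "\<lambda>d e (i, j). smul (h i * C (M - i - j) a d) (\<psi> b i (\<psi> e j v))"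
  let ?F = "\<lambda>p. ?f Plus Minus p - ?f Minus Plus p"
  have fin: "finite {p. ?f d e p \<noteq> 0}" for d e
  proof (rule finite_D_terms)
    fix i j assume "h i * C (M - i - j) a d \<noteq> 0"
    then have "h i \<noteq> 0" "\<not> M - i - j \<ge> L" using L by auto
    then show "j \<ge> min (M - L) (M - L - c) \<and> i + j \<ge> min (M - L) (M - L - c)" using h[of i] by auto
  qed
  have F: "finite {p. ?F p \<noteq> 0}"
    by (rule finite_support_diff[OF fin fin])
  have sum_eq: "smul (h l) (\<psi> b l (R a (M - l) v)) = Sum_any (\<lambda>j. ?F (l, j))" for l
    unfolding R_def
    by (subst Sum_any_additive[where h = "\<lambda>u. smul (h l) (\<psi> b l u)",
          OF _ finite_support_diff[OF finite_C_terms finite_C_terms]])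
      (auto simp: scale_right_distrib psi_add psi.diff psi_scale scale_right_diff_distrib algebra_simps)
  show "finite {l. smul (h l) (\<psi> b l (R a (M - l) v)) \<noteq> 0}"
    unfolding sum_eq by (rule finite_support_iterated(1)[OF F])
  have "Sum_any (\<lambda>l. smul (h l) (\<psi> b l (R a (M - l) v))) = Sum_any ?F"
    unfolding sum_eq by (rule Sum_any_pairs[OF F])
  then show "Sum_any (\<lambda>l. smul (h l) (\<psi> b l (R a (M - l) v)))
      = D b Minus (\<lambda>i j. h i * C (M - i - j) a Plus) v - D b Plus (\<lambda>i j. h i * C (M - i - j) a Minus) v"
    unfolding D_def by (simp only: Sum_any_diff[OF fin fin])
qed

text \<open>The connection part of \<open>\<kappa>\<close> depends on \<open>i + j\<close> only and
  is summed over antidiagonals. The central part lives on \<open>j = - i\<close>, where the quadrant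
  weight is the signed interval from \<open>t + 1\<close> to \<open>- n\<close>.\<close>

lemma quadrant_sum:
  fixes n t M :: int and a b c d :: pm
  defines "w \<equiv> \<lambda>i j. (of_bool (j > n) - of_bool (i \<le> t)) * C (M - i - j) c d"
  shows "finite {(i, j). w i j * \<kappa> a b i j \<noteq> 0}"
    and "Sum_any (\<lambda>(i, j). w i j * \<kappa> a b i j)
      = Sum_any (\<lambda>s. of_int (s - n - t - 1) * (C (M - s) c d * C s a b))
        + (of_int (n * (n + 1)) - of_int (t * (t + 1))) / 2 * omega a b * C M c d"
proof -
  obtain L where L: "\<And>k a b. k \<ge> L \<Longrightarrow> C k a b = 0" using C_bound by blast
  let ?f = "\<lambda>s. C (M - s) c d * C s a b"
  have f: "finite {s. ?f s \<noteq> 0}"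
  proof (rule finite_between_int)
    fix s assume "?f s \<noteq> 0"
    then show "M - L \<le> s \<and> s \<le> L" by (rule contrapos_np) (auto simp: L)
  qed
  let ?g = "\<lambda>(i, j). (of_bool (j > n) - of_bool (i \<le> t)) * ?f (i + j)"
  let ?e = "\<lambda>(i, j). if j = - i then (of_bool (i < - n) - of_bool (i < t + 1)) * (of_int i * omega a b * C M c d) else 0"
  have g: "finite {p. ?g p \<noteq> 0}"
    using Sum_any_quadrants(1)[OF f, of n t] unfolding case_prod_beta' .
  have e: "finite {p. ?e p \<noteq> 0}"
    by (rule finite_subset[of _ "(\<lambda>i. (i, - i)) ` {min (- n) (t + 1)..<max (- n) (t + 1)}"])
      (auto simp: of_bool_def split: if_splits)
  have eq: "(case p of (i, j) \<Rightarrow> w i j * \<kappa> a b i j) = ?g p + ?e p" for p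
    by (cases p) (auto simp: w_def \<kappa>_def algebra_simps add_eq_0_iff)
  have "finite {p. (case p of (i, j) \<Rightarrow> w i j * \<kappa> a b i j) \<noteq> 0}"
    unfolding eq by (rule finite_support_add[OF g e])
  then show "finite {(i, j). w i j * \<kappa> a b i j \<noteq> 0}"
    unfolding case_prod_beta' .
  have "Sum_any ?e = Sum_any (\<lambda>i. (of_bool (i < - n) - of_bool (i < t + 1)) * (of_int i * omega a b * C M c d))"
    by (subst Sum_any_pairs[OF e, symmetric]) simp
  \<comment> \<open>\<open>i * (i - 1) / 2\<close> is an antidifference of \<open>i\<close>; its
    values at \<open>- n\<close> and \<open>t + 1\<close> are the two quadratic terms.\<close>
  also have "\<dots> = (of_int (n * (n + 1)) - of_int (t * (t + 1))) / 2 * omega a b * C M c d"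
    by (subst Sum_any_telescope[where F = "\<lambda>i. of_int (i * (i - 1)) / 2 * omega a b * C M c d"])
      (auto simp: field_simps)
  finally have "Sum_any ?e = (of_int (n * (n + 1)) - of_int (t * (t + 1))) / 2 * omega a b * C M c d" .
  then show "Sum_any (\<lambda>(i, j). w i j * \<kappa> a b i j)
      = Sum_any (\<lambda>s. of_int (s - n - t - 1) * (C (M - s) c d * C s a b))
        + (of_int (n * (n + 1)) - of_int (t * (t + 1))) / 2 * omega a b * C M c d"
    unfolding eq by (subst Sum_any.distrib[OF g e]) (simp only: Sum_any_quadrants(2)[OF f])
qed

lemma quadrant_lower_bound:
  obtains u where "\<And>i j. (of_bool (j > n) - of_bool (i \<le> t)) * C (M - i - j) c d \<noteq> 0
    \<Longrightarrow> i \<ge> u \<and> j \<ge> u \<and> i + j \<ge> u"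
proof -
  obtain L where L: "\<And>k a b. k \<ge> L \<Longrightarrow> C k a b = 0" using C_bound by blast
  \<comment> \<open>On the quadrant \<open>i > t\<close>, \<open>j > n\<close> the thresholds bound
    the indices. On the opposite one, \<open>i + j > M - L\<close> gives
    \<open>i > M - L - n\<close> and \<open>j > M - L - t\<close>.\<close>
  let ?S = "{t, n, t + n, M - L, M - L - t, M - L - n}"
  show thesis
  proof (rule that[of "Min ?S"])
    fix i j assume "(of_bool (j > n) - of_bool (i \<le> t)) * C (M - i - j) c d \<noteq> 0"
    then have "j > n \<and> i > t \<or> j \<le> n \<and> i \<le> t" "\<not> M - i - j \<ge> L"
      using L[of "M - i - j" c d] by (auto simp: of_bool_def split: if_splits)
    moreover have "Min ?S \<le> x" if "x \<in> ?S" for x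
      using that by (intro Min_le) auto
    then have "Min ?S \<le> t" "Min ?S \<le> n" "Min ?S \<le> t + n" "Min ?S \<le> M - L"
        "Min ?S \<le> M - L - t" "Min ?S \<le> M - L - n"
      by blast+
    ultimately show "i \<ge> Min ?S \<and> j \<ge> Min ?S \<and> i + j \<ge> Min ?S" by linarith
  qed
qed

lemma D_quadrant:
  fixes n t M :: int and c d :: pm
  defines "w \<equiv> \<lambda>i j. (of_bool (j > n) - of_bool (i \<le> t)) * C (M - i - j) c d"
  shows "D a b w v + D b a (\<lambda>j i. w i j) v
    = smul (Sum_any (\<lambda>s. of_int (s - n - t - 1) * (C (M - s) c d * C s a b))
        + (of_int (n * (n + 1)) - of_int (t * (t + 1))) / 2 * omega a b * C M c d) v"
proof -
  obtain u where "\<And>i j. w i j \<noteq> 0 \<Longrightarrow> i \<ge> u \<and> j \<ge> u \<and> i + j \<ge> u"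
    unfolding w_def using quadrant_lower_bound by blast
  from D_anticomm[OF this quadrant_sum(1)[where M = M and c = c and d = d, folded w_def]]
  show ?thesis
    unfolding w_def quadrant_sum(2) .
qed

text \<open>In each sum alone \<open>i\<close> may be unbounded below, so its factors cannot be
  swapped. The common region \<open>j > n\<close>, \<open>i \<le> t\<close> cancels in the
  difference, and the quadrants that remain admit \<open>D_anticomm\<close>.\<close>

lemma D_outer_inner_diff:
  "D a b (\<lambda>i j. of_bool (j > n) * C (M - i - j) c d) v - D a b (\<lambda>i j. of_bool (i \<le> t) * C (M - i - j) c d) v
   = D a b (\<lambda>i j. (of_bool (j > n) - of_bool (i \<le> t)) * C (M - i - j) c d) v"
proof -
  obtain L where L: "\<And>k a b. k \<ge> L \<Longrightarrow> C k a b = 0" using C_bound by blast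
  have *: "i + j \<ge> M - L" if "C (M - i - j) c d \<noteq> 0" for i j
    by (rule ccontr) (use that L in auto)
  have "j \<ge> min n (M - L) \<and> i + j \<ge> min n (M - L)"
    if "of_bool (j > n) * C (M - i - j) c d \<noteq> 0" for i j
    using *[of i j] that by auto
  moreover have "j \<ge> min (M - L - t) (M - L) \<and> i + j \<ge> min (M - L - t) (M - L)"
    if "of_bool (i \<le> t) * C (M - i - j) c d \<noteq> 0" for i j
    using *[of i j] that by auto
  ultimately show ?thesis
    by (subst D_diff) (simp_all add: left_diff_distrib)
qed

text \<open>With equal thresholds the weight is symmetric in \<open>i\<close> and \<open>j\<close>,
  so for equal signs the swapped sum is the sum itself and \<open>D_quadrant\<close> yields twice
  its value. The central term drops out because \<open>omega a a = 0\<close>.\<close>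

lemma D_diagonal_quadrant:
  "D a a (\<lambda>i j. (of_bool (j > n) - of_bool (i \<le> n)) * C (M - i - j) c d) v
    = smul (1/2 * Sum_any (\<lambda>s. of_int (s - 2 * n - 1) * (C (M - s) c d * C s a a))) v"
    (is "?x = smul (1/2 * ?s) v")
proof -
  have sw: "(\<lambda>j i. (of_bool (j > n) - of_bool (i \<le> n)) * C (M - i - j) c d)
    = (\<lambda>i j. (of_bool (j > n) - of_bool (i \<le> n)) * C (M - i - j) c d)"
    by (auto simp: fun_eq_iff of_bool_def algebra_simps)
  have "?x + ?x = smul ?s v"
    using D_quadrant[of a a n n M c d v] by (simp add: sw)
  then have "smul 2 ?x = smul ?s v"
    using scale_left_distrib[of 1 1 ?x] by simp
  then have "smul (1/2) (smul 2 ?x) = smul (1/2) (smul ?s v)"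
    by simp
  then show ?thesis by simp
qed

lemma finite_CC: "finite {s. C (M - s) a b * C s c d \<noteq> 0}"
proof -
  obtain L where L: "\<And>k a b. k \<ge> L \<Longrightarrow> C k a b = 0" using C_bound by blast
  show ?thesis
  proof (rule finite_between_int)
    fix s assume "C (M - s) a b * C s c d \<noteq> 0"
    then show "M - L \<le> s \<and> s \<le> L" by (rule contrapos_np) (auto simp: L)
  qed
qed

definition c_term :: "int \<Rightarrow> complex" where
  "c_term n = 1/2 * Sum_any (\<lambda>i. C i Minus Plus * C (n - i) Plus Minus - C i Plus Plus * C (n - i) Minus Minus)"

text \<open>The reflection \<open>s \<mapsto> m + n - s\<close> preserves the first product and
  exchanges the other two. The weights \<open>s - n\<close> and \<open>m - s\<close> average to
  \<open>(m - n) / 2\<close>, while \<open>s - 2 * n - 1\<close> and \<open>m + n - s + 1\<close>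
  add up to \<open>m - n\<close>.\<close>

lemma weighted_sums:
  "Sum_any (\<lambda>s. of_int (s - n) * (C (m + n - s) Minus Plus * C s Minus Plus))
   - 1/2 * Sum_any (\<lambda>s. of_int (s - 2 * n - 1) * (C (m + n - s) Minus Minus * C s Plus Plus))
   - 1/2 * Sum_any (\<lambda>s. of_int (s + 1) * (C (m + n - s) Plus Plus * C s Minus Minus))
   = of_int (m - n) * c_term (m + n)"
proof -
  let ?M = "m + n"
  let ?f = "\<lambda>s. C (?M - s) Minus Plus * C s Minus Plus"
  let ?g = "\<lambda>s. C (?M - s) Minus Minus * C s Plus Plus"
  have fin: "finite {s. k s * (C (?M - s) a b * C s c d) \<noteq> 0}" for k :: "int \<Rightarrow> complex" and a b c d
    by (rule finite_subset[OF _ finite_CC[of ?M a b c d]]) auto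
  note fin1 = fin[where k = "\<lambda>_. c" for c]
  have refl_f: "Sum_any (\<lambda>s. of_int (s - n) * ?f s) = Sum_any (\<lambda>s. of_int (m - s) * ?f s)"
    by (rule Sum_any.reindex_cong[OF bij_int_shift(2)[of ?M]]) (simp add: fun_eq_iff)
  have "2 * Sum_any (\<lambda>s. of_int (s - n) * ?f s) = Sum_any (\<lambda>s. of_int (s - n) * ?f s + of_int (m - s) * ?f s)"
    by (subst Sum_any.distrib[OF fin fin]) (simp only: refl_f mult_2)
  also have "\<dots> = Sum_any (\<lambda>s. of_int (m - n) * ?f s)"
    by (simp add: algebra_simps)
  also have "\<dots> = of_int (m - n) * Sum_any ?f"
    by (rule Sum_any_right_distrib[OF finite_CC, symmetric])
  finally have F: "Sum_any (\<lambda>s. of_int (s - n) * ?f s) = of_int (m - n) / 2 * Sum_any ?f"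
    by (simp only: eq_divide_eq_numeral1 times_divide_eq_left mult.commute) simp
  have "Sum_any (\<lambda>s. of_int (s + 1) * (C (?M - s) Plus Plus * C s Minus Minus))
      = Sum_any (\<lambda>s. of_int (?M - s + 1) * ?g s)"
    by (rule Sum_any.reindex_cong[OF bij_int_shift(2)[of ?M]]) (simp add: fun_eq_iff mult.commute)
  then have "Sum_any (\<lambda>s. of_int (s - 2 * n - 1) * ?g s)
      + Sum_any (\<lambda>s. of_int (s + 1) * (C (?M - s) Plus Plus * C s Minus Minus))
      = Sum_any (\<lambda>s. of_int (s - 2 * n - 1) * ?g s + of_int (?M - s + 1) * ?g s)"
    by (subst Sum_any.distrib[OF fin fin]) (simp only:)
  also have "\<dots> = Sum_any (\<lambda>s. of_int (m - n) * ?g s)"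
    by (simp add: algebra_simps)
  also have "\<dots> = of_int (m - n) * Sum_any ?g"
    by (rule Sum_any_right_distrib[OF finite_CC, symmetric])
  finally have G: "Sum_any (\<lambda>s. of_int (s - 2 * n - 1) * ?g s)
      + Sum_any (\<lambda>s. of_int (s + 1) * (C (?M - s) Plus Plus * C s Minus Minus)) = of_int (m - n) * Sum_any ?g" .
  have "c_term ?M = 1/2 * Sum_any (\<lambda>s. ?f s - ?g s)"
    unfolding c_term_def by (simp add: C_sym[of _ Plus Minus] mult.commute)
  also have "Sum_any (\<lambda>s. ?f s - ?g s) = Sum_any ?f - Sum_any ?g"
    by (rule Sum_any_diff[OF finite_CC finite_CC])
  finally have c: "c_term ?M = 1/2 * (Sum_any ?f - Sum_any ?g)" .
  have arith: "k / 2 * p - 1/2 * x - 1/2 * y = k * (1/2 * (p - q))" if "x + y = k * q" for k p q x y :: complex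
  proof -
    have "y = k * q - x" using that by (simp add: eq_diff_eq add.commute)
    then show ?thesis by (simp add: field_simps)
  qed
  show ?thesis
    unfolding F c by (rule arith[OF G])
qed

lemma correction_sum:
  fixes m n :: int and v :: 'v
  defines "M \<equiv> m + n"
  defines "B \<equiv> \<lambda>k. smul (of_bool (k < 0)) (R Minus (m + k) (\<psi> Plus (n - k) v))
      + smul (of_bool (k < 0)) (\<psi> Minus k (R Plus (M - k) v))
      - smul (of_bool (k \<ge> 0)) (R Plus (M - k) (\<psi> Minus k v))
      - smul (of_bool (k \<ge> 0)) (\<psi> Plus (n - k) (R Minus (m + k) v))"
  shows "finite {k. B k \<noteq> 0}"
    and "Sum_any B = smul (of_int (m - n) * c_term M - of_int (n * (n + 1)) / 2 * C M Minus Plus) v"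
proof -
  let ?B1 = "\<lambda>k. smul (of_bool (k < 0)) (R Minus (m + k) (\<psi> Plus (n - k) v))"
  let ?B2 = "\<lambda>k. smul (of_bool (k < 0)) (\<psi> Minus k (R Plus (M - k) v))"
  let ?B3 = "\<lambda>k. smul (of_bool (k \<ge> 0)) (R Plus (M - k) (\<psi> Minus k v))"
  let ?B4 = "\<lambda>k. smul (of_bool (k \<ge> 0)) (\<psi> Plus (n - k) (R Minus (m + k) v))"
  let ?B1' = "\<lambda>l. smul (of_bool (l > n)) (R Minus (M - l) (\<psi> Plus l v))"
  let ?B4' = "\<lambda>l. smul (of_bool (l \<le> n)) (\<psi> Plus l (R Minus (M - l) v))"
  have B1: "?B1 k = ?B1' (n - k)" and B4: "?B4 k = ?B4' (n - k)" for k
    by (simp_all add: M_def)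
  have h: "of_bool (l > n) \<noteq> (0::complex) \<Longrightarrow> l \<ge> n" "of_bool (l \<le> n) \<noteq> (0::complex) \<Longrightarrow> l \<le> n" for l n :: int
    by (simp_all add: of_bool_def split: if_splits)
  note o1 = outer_correction[where h = "\<lambda>l. of_bool (l > n)", OF h(1), where a = Minus and M = M and b = Plus and v = v]
    and o2 = inner_correction[where h = "\<lambda>l. of_bool (l \<le> - 1)", OF h(2), where a = Plus and M = M and b = Minus and v = v]
    and o3 = outer_correction[where h = "\<lambda>l. of_bool (l > - 1)", OF h(1), where a = Plus and M = M and b = Minus and v = v]
    and o4 = inner_correction[where h = "\<lambda>l. of_bool (l \<le> n)", OF h(2), where a = Minus and M = M and b = Plus and v = v]
  \<comment> \<open>Strict and weak bounds are written with the threshold \<open>- 1\<close>, for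
    which \<open>t * (t + 1) = 0\<close>; so only \<open>n\<close> contributes a quadratic
    term.\<close>
  have neg: "k < 0 \<longleftrightarrow> k \<le> - 1" "k \<ge> 0 \<longleftrightarrow> k > - 1" for k :: int by auto
  have f1: "finite {k. ?B1 k \<noteq> 0}"
    using finite_support_reindex[OF bij_int_shift(2) o1(1)] unfolding B1 .
  have s1: "Sum_any ?B1 = Sum_any ?B1'"
    unfolding B1 by (rule Sum_any.reindex_cong[OF bij_int_shift(2)[of n], symmetric]) (simp add: fun_eq_iff)
  have f4: "finite {k. ?B4 k \<noteq> 0}"
    using finite_support_reindex[OF bij_int_shift(2) o4(1)] unfolding B4 .
  have s4: "Sum_any ?B4 = Sum_any ?B4'"
    unfolding B4 by (rule Sum_any.reindex_cong[OF bij_int_shift(2)[of n], symmetric]) (simp add: fun_eq_iff)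
  have f2: "finite {k. ?B2 k \<noteq> 0}" and f3: "finite {k. ?B3 k \<noteq> 0}"
    unfolding neg using o2(1) o3(1) by auto
  show "finite {k. B k \<noteq> 0}"
    unfolding B_def by (intro finite_support_diff finite_support_add f1 f2 f3 f4)
  \<comment> \<open>By the symmetry of \<open>C\<close>, the weight of the \<open>Plus Minus\<close>
    sum is the transpose of the weight of the \<open>Minus Plus\<close> sum, as
    \<open>D_quadrant\<close> requires.\<close>
  have sw: "(\<lambda>i j. (of_bool (j > - 1) - of_bool (i \<le> n)) * C (M - i - j) Plus Minus)
    = (\<lambda>j i. (of_bool (j > n) - of_bool (i \<le> - 1)) * C (M - i - j) Minus Plus)"
    by (auto simp: fun_eq_iff of_bool_def algebra_simps C_sym[of _ Plus Minus])
  have idx: "s - 2 * - 1 - 1 = s + 1" "s - n - - 1 - 1 = s - n" for s :: int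
    by simp_all
  have "Sum_any B = Sum_any ?B1' + Sum_any ?B2 - Sum_any ?B3 - Sum_any ?B4'"
    unfolding B_def
    by (subst Sum_any_diff[OF finite_support_diff[OF finite_support_add[OF f1 f2] f3] f4],
        subst Sum_any_diff[OF finite_support_add[OF f1 f2] f3], subst Sum_any.distrib[OF f1 f2])
      (simp only: s1 s4)
  \<comment> \<open>The eight double sums are grouped by the signs of their two modes; each group is
    a sum with \<open>R\<close> outside and one with \<open>R\<close> inside, whose difference is a
    quadrant sum.\<close>
  also have "\<dots> = (D Minus Plus (\<lambda>i j. of_bool (j > n) * C (M - i - j) Minus Plus) v
        - D Minus Plus (\<lambda>i j. of_bool (i \<le> - 1) * C (M - i - j) Minus Plus) v)
      + (D Plus Minus (\<lambda>i j. of_bool (j > - 1) * C (M - i - j) Plus Minus) v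
        - D Plus Minus (\<lambda>i j. of_bool (i \<le> n) * C (M - i - j) Plus Minus) v)
      - (D Plus Plus (\<lambda>i j. of_bool (j > n) * C (M - i - j) Minus Minus) v
        - D Plus Plus (\<lambda>i j. of_bool (i \<le> n) * C (M - i - j) Minus Minus) v)
      - (D Minus Minus (\<lambda>i j. of_bool (j > - 1) * C (M - i - j) Plus Plus) v
        - D Minus Minus (\<lambda>i j. of_bool (i \<le> - 1) * C (M - i - j) Plus Plus) v)"
    unfolding neg using o1(2) o2(2) o3(2) o4(2) by (simp add: C_sym[of _ Plus Minus])
  also have "\<dots> = smul (of_int (m - n) * c_term M - of_int (n * (n + 1)) / 2 * C M Minus Plus) v"
    unfolding D_outer_inner_diff D_diagonal_quadrant sw D_quadrant idx
    unfolding M_def weighted_sums[of n m, symmetric]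
    by (simp add: scale_left_distrib scale_left_diff_distrib C_sym[of _ Plus Minus])
  finally show "Sum_any B = smul (of_int (m - n) * c_term M - of_int (n * (n + 1)) / 2 * C M Minus Plus) v" .
qed

section \<open>The free part and the cubic cocycle\<close>

lemma finite_bilinear_terms:
  shows "(\<And>k. w k \<noteq> 0 \<Longrightarrow> k \<le> c) \<Longrightarrow> finite {k. smul (w k) (\<psi> a k (\<psi> b (M - k) v)) \<noteq> 0}"
    and "(\<And>k. w k \<noteq> 0 \<Longrightarrow> k \<ge> c) \<Longrightarrow> finite {k. smul (w k) (\<psi> a (M - k) (\<psi> b k v)) \<noteq> 0}"
proof -
  obtain K where K: "\<And>u a n. n \<ge> K u \<Longrightarrow> \<psi> a n u = 0" using cutoff by blast
  show "finite {k. smul (w k) (\<psi> a k (\<psi> b (M - k) v)) \<noteq> 0}" if "\<And>k. w k \<noteq> 0 \<Longrightarrow> k \<le> c"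
  proof (rule finite_between_int)
    fix k assume *: "smul (w k) (\<psi> a k (\<psi> b (M - k) v)) \<noteq> 0"
    then have "\<not> M - k \<ge> K v" by (rule contrapos_nn) (simp add: K psi.zero)
    with * that[of k] show "M - K v \<le> k \<and> k \<le> c" by auto
  qed
  show "finite {k. smul (w k) (\<psi> a (M - k) (\<psi> b k v)) \<noteq> 0}" if "\<And>k. w k \<noteq> 0 \<Longrightarrow> k \<ge> c"
  proof (rule finite_between_int)
    fix k assume *: "smul (w k) (\<psi> a (M - k) (\<psi> b k v)) \<noteq> 0"
    then have "\<not> k \<ge> K v" by (rule contrapos_nn) (simp add: K psi.zero)
    with * that[of k] show "c \<le> k \<and> k \<le> K v" by auto
  qed
qed

text \<open>For \<open>m \<ge> 0\<close> these are the sums of \<open>m - k\<close> and of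
  \<open>(m - k) * k\<close> over \<open>0 \<le> k < m\<close>. The second one is the cocycle of
  central charge -2.\<close>

lemma free_part_scalar:
  "finite {k. (of_bool (k < m) - of_bool (k < 0)) * of_int (m - k) * \<kappa> Minus Plus k (M - k) \<noteq> 0}" (is ?F)
  "Sum_any (\<lambda>k. (of_bool (k < m) - of_bool (k < 0)) * of_int (m - k) * \<kappa> Minus Plus k (M - k))
   = of_int (m * (m + 1)) / 2 * C M Minus Plus - (if M = 0 then of_int (m ^ 3 - m) / 6 else 0)" (is ?S)
proof -
  have k: "\<kappa> Minus Plus k (M - k) = C M Minus Plus - (if M = 0 then of_int k else 0)" for k
    by (simp add: \<kappa>_def)
  show ?F
    by (rule finite_between_int[of _ "min 0 m" "max 0 m"]) (auto simp: of_bool_def split: if_splits)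
  \<comment> \<open>\<open>F\<close> is an antidifference in \<open>k\<close> of
    \<open>(m - k)\<close> times the two summands of \<open>\<kappa>\<close>, built from the closed
    forms for sums of integers and of squares; it vanishes at \<open>k = 0\<close>.\<close>
  show ?S
    unfolding mult.assoc
  proof (subst Sum_any_telescope[where F = "\<lambda>k. (of_int (m * k) - of_int (k * (k - 1)) / 2) * C M Minus Plus
        - (if M = 0 then of_int (k * (k - 1)) / 2 * of_int m - of_int ((k - 1) * k * (2 * k - 1)) / 6 else 0)"])
  qed (auto simp: k field_simps power3_eq_cube)
qed

text \<open>Shifting \<open>k\<close> by \<open>m\<close> in the first and third sum moves their
  boundary between the two orders from 0 to \<open>m\<close>. Outside the interval between 0 and
  \<open>m\<close> the coefficients add up to \<open>m - n\<close>, up to the sign in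
  \<open>ord_term\<close>; inside it one product stands in the order opposite to
  \<open>ord_term\<close>, and reordering it leaves the scalar \<open>?w k\<close>.\<close>

lemma free_part_sum:
  fixes m n :: int and v :: 'v
  defines "M \<equiv> m + n"
  defines "E \<equiv> \<lambda>k. smul (of_bool (k < 0) * of_int (- k)) (\<psi> Minus (m + k) (\<psi> Plus (n - k) v))
      + smul (of_bool (k < 0) * of_int (k - n)) (\<psi> Minus k (\<psi> Plus (M - k) v))
      + smul (of_bool (k \<ge> 0) * of_int k) (\<psi> Plus (n - k) (\<psi> Minus (m + k) v))
      + smul (of_bool (k \<ge> 0) * of_int (n - k)) (\<psi> Plus (M - k) (\<psi> Minus k v))"
  shows "finite {k. E k \<noteq> 0}"
    and "Sum_any E = smul (of_int (m - n)) (S M v)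
      + smul (of_int (m * (m + 1)) / 2 * C M Minus Plus - (if M = 0 then of_int (m ^ 3 - m) / 6 else 0)) v"
proof -
  let ?q = "\<lambda>k. \<psi> Minus k (\<psi> Plus (M - k) v)" and ?p = "\<lambda>k. \<psi> Plus (M - k) (\<psi> Minus k v)"
  let ?A1 = "\<lambda>k. smul (of_bool (k < 0) * of_int (- k)) (\<psi> Minus (m + k) (\<psi> Plus (n - k) v))"
  let ?A1' = "\<lambda>k. smul (of_bool (k < m) * of_int (m - k)) (?q k)"
  let ?A2 = "\<lambda>k. smul (of_bool (k < 0) * of_int (k - n)) (?q k)"
  let ?A3 = "\<lambda>k. smul (of_bool (k \<ge> 0) * of_int k) (\<psi> Plus (n - k) (\<psi> Minus (m + k) v))"
  let ?A3' = "\<lambda>k. smul (of_bool (k \<ge> m) * of_int (k - m)) (?p k)"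
  let ?A4 = "\<lambda>k. smul (of_bool (k \<ge> 0) * of_int (n - k)) (?p k)"
  let ?w = "\<lambda>k. (of_bool (k < m) - of_bool (k < 0)) * of_int (m - k) * \<kappa> Minus Plus k (M - k)"
  have A1: "?A1 k = ?A1' (k + m)" and A3: "?A3 k = ?A3' (k + m)" for k
    by (simp_all add: M_def algebra_simps)
  have f1': "finite {k. ?A1' k \<noteq> 0}"
    by (rule finite_bilinear_terms(1)[of _ m]) auto
  have f3': "finite {k. ?A3' k \<noteq> 0}"
    by (rule finite_bilinear_terms(2)[of _ m]) auto
  have f2: "finite {k. ?A2 k \<noteq> 0}"
    by (rule finite_bilinear_terms(1)[of _ 0]) auto
  have f4: "finite {k. ?A4 k \<noteq> 0}"
    by (rule finite_bilinear_terms(2)[of _ 0]) auto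
  have f1: "finite {k. ?A1 k \<noteq> 0}" and s1: "Sum_any ?A1 = Sum_any ?A1'"
    unfolding A1
    by (rule finite_support_reindex[OF bij_int_shift(1) f1'],
        rule Sum_any.reindex_cong[OF bij_int_shift(1)[of m], symmetric], simp add: fun_eq_iff)
  have f3: "finite {k. ?A3 k \<noteq> 0}" and s3: "Sum_any ?A3 = Sum_any ?A3'"
    unfolding A3
    by (rule finite_support_reindex[OF bij_int_shift(1) f3'],
        rule Sum_any.reindex_cong[OF bij_int_shift(1)[of m], symmetric], simp add: fun_eq_iff)
  show "finite {k. E k \<noteq> 0}"
    unfolding E_def by (intro finite_support_add f1 f2 f3 f4)
  have fS: "finite {k. smul (of_int (m - n)) (ord_term M k v) \<noteq> 0}"
    by (rule finite_subset[OF _ finite_ord_terms[of M v]]) auto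
  have fw: "finite {k. smul (?w k) v \<noteq> 0}"
    by (rule finite_subset[OF _ free_part_scalar(1)[of m M]]) auto
  have eq: "?A1' k + ?A2 k + ?A3' k + ?A4 k = smul (of_int (m - n)) (ord_term M k v) + smul (?w k) v" for k
  proof -
    have q: "?q k = smul (\<kappa> Minus Plus k (M - k)) v - ?p k"
      using anticomm'[of Minus k Plus "M - k" v] by (simp add: eq_diff_eq)
    show ?thesis
      by (cases "k < m"; cases "k < 0")
        (simp_all add: ord_term_def q scale_right_diff_distrib scale_left_diff_distrib left_diff_distrib algebra_simps)
  qed
  have "Sum_any E = Sum_any ?A1' + Sum_any ?A2 + Sum_any ?A3' + Sum_any ?A4"
    unfolding E_def
    by (subst Sum_any.distrib[OF finite_support_add[OF finite_support_add[OF f1 f2] f3] f4],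
        subst Sum_any.distrib[OF finite_support_add[OF f1 f2] f3], subst Sum_any.distrib[OF f1 f2])
      (simp only: s1 s3)
  also have "\<dots> = Sum_any (\<lambda>k. ?A1' k + ?A2 k + ?A3' k + ?A4 k)"
    by (subst Sum_any.distrib[OF finite_support_add[OF finite_support_add[OF f1' f2] f3'] f4],
        subst Sum_any.distrib[OF finite_support_add[OF f1' f2] f3'], subst Sum_any.distrib[OF f1' f2]) (rule refl)
  also have "\<dots> = Sum_any (\<lambda>k. smul (of_int (m - n)) (ord_term M k v)) + Sum_any (\<lambda>k. smul (?w k) v)"
    unfolding eq by (rule Sum_any.distrib[OF fS fw])
  also have "Sum_any (\<lambda>k. smul (of_int (m - n)) (ord_term M k v)) = smul (of_int (m - n)) (S M v)"
    unfolding S_def by (rule Sum_any_additive[OF scale_right_distrib finite_ord_terms, symmetric])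
  also have "Sum_any (\<lambda>k. smul (?w k) v) = smul (Sum_any ?w) v"
    by (rule Sum_any_additive[OF scale_left_distrib free_part_scalar(1), symmetric])
  finally show "Sum_any E = smul (of_int (m - n)) (S M v)
      + smul (of_int (m * (m + 1)) / 2 * C M Minus Plus - (if M = 0 then of_int (m ^ 3 - m) / 6 else 0)) v"
    unfolding free_part_scalar(2) .
qed

section \<open>The commutator of the reordered sums\<close>

lemma S_commutator:
  "S m (S n v) - S n (S m v) = smul (of_int (m - n)) (S (m + n) v)
    + smul (of_int (m - n) * (of_int (m + n + 1) / 2 * C (m + n) Minus Plus + c_term (m + n))
        - (if m + n = 0 then of_int (m ^ 3 - m) / 6 else 0)) v"
proof -
  have comm: "S m (\<psi> a k u) = \<psi> a k (S m u) + smul (- of_int k) (\<psi> a (m + k) u) + R a (m + k) u" for a k u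
    using S_comm[of m a k u] by (simp add: algebra_simps)
  \<comment> \<open>Leibniz rule: \<open>S_comm\<close> is applied to both factors in turn. The
    multiples of modes form the first bracket, the \<open>R\<close> terms the second.\<close>
  have eq: "S m (ord_term n k v) - ord_term n k (S m v) =
      (smul (of_bool (k < 0) * of_int (- k)) (\<psi> Minus (m + k) (\<psi> Plus (n - k) v))
      + smul (of_bool (k < 0) * of_int (k - n)) (\<psi> Minus k (\<psi> Plus (m + n - k) v))
      + smul (of_bool (k \<ge> 0) * of_int k) (\<psi> Plus (n - k) (\<psi> Minus (m + k) v))
      + smul (of_bool (k \<ge> 0) * of_int (n - k)) (\<psi> Plus (m + n - k) (\<psi> Minus k v)))
      + (smul (of_bool (k < 0)) (R Minus (m + k) (\<psi> Plus (n - k) v))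
      + smul (of_bool (k < 0)) (\<psi> Minus k (R Plus (m + n - k) v))
      - smul (of_bool (k \<ge> 0)) (R Plus (m + n - k) (\<psi> Minus k v))
      - smul (of_bool (k \<ge> 0)) (\<psi> Plus (n - k) (R Minus (m + k) v)))" for k
    by (cases "k < 0")
      (simp_all add: ord_term_def comm S.minus psi_add psi.diff psi.minus psi_scale scale_right_diff_distrib
        scale_left_diff_distrib scale_right_distrib algebra_simps)
  have fin: "finite {k. S m (ord_term n k v) \<noteq> 0}"
    by (rule finite_subset[OF _ finite_ord_terms[of n v]]) (auto simp: S.zero)
  have "S m (S n v) = Sum_any (\<lambda>k. S m (ord_term n k v))"
    unfolding S_def[of n] by (rule Sum_any_additive[OF S_add finite_ord_terms])
  then have "S m (S n v) - S n (S m v) = Sum_any (\<lambda>k. S m (ord_term n k v) - ord_term n k (S m v))"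
    unfolding S_def[of n "S m v"] by (simp only: Sum_any_diff[OF fin finite_ord_terms])
  also have "\<dots> = smul (of_int (m - n)) (S (m + n) v)
      + smul (of_int (m * (m + 1)) / 2 * C (m + n) Minus Plus - (if m + n = 0 then of_int (m ^ 3 - m) / 6 else 0)) v
      + smul (of_int (m - n) * c_term (m + n) - of_int (n * (n + 1)) / 2 * C (m + n) Minus Plus) v"
    unfolding eq
    by (subst Sum_any.distrib[OF free_part_sum(1) correction_sum(1)]) (simp only: free_part_sum(2) correction_sum(2))
  also have "\<dots> = smul (of_int (m - n)) (S (m + n) v)
      + smul ((of_int (m * (m + 1)) / 2 * C (m + n) Minus Plus - (if m + n = 0 then of_int (m ^ 3 - m) / 6 else 0))
        + (of_int (m - n) * c_term (m + n) - of_int (n * (n + 1)) / 2 * C (m + n) Minus Plus)) v"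
    by (simp only: scale_left_distrib add.assoc)
  \<comment> \<open>The factorization
    \<open>m * (m + 1) - n * (n + 1) = (m - n) * (m + n + 1)\<close> makes the scalar linear in
    \<open>C\<close> a multiple of \<open>m - n\<close> as well.\<close>
  also have "(of_int (m * (m + 1)) / 2 * C (m + n) Minus Plus - (if m + n = 0 then of_int (m ^ 3 - m) / 6 else 0))
        + (of_int (m - n) * c_term (m + n) - of_int (n * (n + 1)) / 2 * C (m + n) Minus Plus)
      = of_int (m - n) * (of_int (m + n + 1) / 2 * C (m + n) Minus Plus + c_term (m + n))
        - (if m + n = 0 then of_int (m ^ 3 - m) / 6 else 0)"
    by (simp add: field_simps)
  finally show ?thesis .
qed

section \<open>Back to normal ordering\<close>

definition normal_term :: "int \<Rightarrow> int \<Rightarrow> 'v \<Rightarrow> 'v" where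
  "normal_term n i u =
    (if i < n - i then \<psi> Minus i (\<psi> Plus (n - i) u)
     else if i > n - i then - \<psi> Plus (n - i) (\<psi> Minus i u)
     else smul (1/2) (\<psi> Minus i (\<psi> Plus (n - i) u) - \<psi> Plus (n - i) (\<psi> Minus i u)))"

definition L :: "int \<Rightarrow> 'v \<Rightarrow> 'v" where
  "L n u = Sum_any (\<lambda>i. normal_term n i u) + smul (c_term n) u"

text \<open>The two orderings disagree only between 0 and \<open>n / 2\<close>. Reordering costs
  \<open>C n Minus Plus\<close> per index, and half of it at a tie \<open>i = n - i\<close>; the
  signed count is \<open>(n + 1) / 2\<close>.\<close>

lemma normal_sum:
  "Sum_any (\<lambda>i. normal_term n i u) = S n u + smul (of_int (n + 1) / 2 * C n Minus Plus) u"
proof -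
  let ?z = "C n Minus Plus / 2"
  \<comment> \<open>\<open>?a\<close> counts \<open>i < n - i\<close> and \<open>?b\<close> counts
    \<open>i \<le> n - i\<close>, each against \<open>i < 0\<close> and with half weight, so that a
    tie receives one half.\<close>
  let ?a = "\<lambda>i. (of_bool (i < (n + 1) div 2) - of_bool (i < 0)) * ?z"
  let ?b = "\<lambda>i. (of_bool (i < n div 2 + 1) - of_bool (i < 0)) * ?z"
  have eq: "normal_term n i u = ord_term n i u + smul (?a i + ?b i) u" for i
  proof -
    let ?p = "\<psi> Plus (n - i) (\<psi> Minus i u)"
    have q: "\<psi> Minus i (\<psi> Plus (n - i) u) = smul (\<kappa> Minus Plus i (n - i)) u - ?p"
      using anticomm'[of Minus i Plus "n - i" u] by (simp add: eq_diff_eq)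
    have k: "\<kappa> Minus Plus i (n - i) = C n Minus Plus - (if n = 0 then of_int i else 0)"
      by (simp add: \<kappa>_def)
    have half: "smul (1/2) (x - y - y) = smul (1/2) x - y" for x y
      using scale_left_distrib[of "1/2" "1/2" y] by (simp add: scale_right_diff_distrib scale_right_distrib diff_diff_eq)
    have d: "i < (n + 1) div 2 \<longleftrightarrow> i < n - i" "i < n div 2 + 1 \<longleftrightarrow> i \<le> n - i" by auto
    have ab: "smul (?a i + ?b i) u
        = smul ((of_bool (i < n - i) + of_bool (i \<le> n - i) - 2 * of_bool (i < 0)) / 2) (smul (C n Minus Plus) u)"
      unfolding d by (simp add: field_simps)
    \<comment> \<open>Wherever the orderings differ, \<open>n \<noteq> 0\<close> or
      \<open>i = 0\<close>, so the central term of \<open>\<kappa>\<close> vanishes.\<close>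
    consider "i < n - i" "i < 0" | "i < n - i" "\<not> i < 0" "n \<noteq> 0" | "i = n - i" "i < 0" "n \<noteq> 0"
      | "i = n - i" "\<not> i < 0" "n \<noteq> 0 \<or> i = 0" | "i > n - i" "i < 0" "n \<noteq> 0" | "i > n - i" "\<not> i < 0"
      by linarith
    then show ?thesis
    proof cases
      case 3
      then have "smul (1/2) (smul (C n Minus Plus) u) - ?p
          = smul (C n Minus Plus) u - ?p + smul (- 1/2) (smul (C n Minus Plus) u)"
        using scale_left_distrib[of 1 "- 1/2" "smul (C n Minus Plus) u"] by simp
      with 3 show ?thesis
        unfolding ab normal_term_def ord_term_def q k half by simp
    next
      case 4
      then show ?thesis
        unfolding ab normal_term_def ord_term_def q k half by auto
    qed (unfold ab normal_term_def ord_term_def q k, simp_all)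
  qed
  have fa: "finite {i. ?a i \<noteq> 0}" and fb: "finite {i. ?b i \<noteq> 0}"
    by (rule finite_subset[OF of_bool_diff_support], simp)+
  have fin: "finite {i. ?a i + ?b i \<noteq> 0}"
    by (rule finite_support_add[OF fa fb])
  have fin': "finite {i. smul (?a i + ?b i) u \<noteq> 0}"
    by (rule finite_subset[OF _ fin]) auto
  have tele: "Sum_any (\<lambda>i. (of_bool (i < b) - of_bool (i < 0)) * ?z) = of_int b * ?z" for b
    using Sum_any_telescope[of "\<lambda>i. of_int i * ?z" "\<lambda>_. ?z" b 0] by (simp add: algebra_simps)
  have "Sum_any (\<lambda>i. ?a i + ?b i) = of_int ((n + 1) div 2 + (n div 2 + 1)) * ?z"
    unfolding Sum_any.distrib[OF fa fb] tele by (simp add: algebra_simps)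
  also have "(n + 1) div 2 + (n div 2 + 1) = n + 1"
    by presburger
  finally have s: "Sum_any (\<lambda>i. ?a i + ?b i) = of_int (n + 1) * ?z" .
  have "Sum_any (\<lambda>i. normal_term n i u) = S n u + Sum_any (\<lambda>i. smul (?a i + ?b i) u)"
    unfolding eq S_def by (rule Sum_any.distrib[OF finite_ord_terms fin'])
  also have "Sum_any (\<lambda>i. smul (?a i + ?b i) u) = smul (Sum_any (\<lambda>i. ?a i + ?b i)) u"
    by (rule Sum_any_additive[OF scale_left_distrib fin, symmetric])
  finally show ?thesis
    unfolding s by (simp only: times_divide_eq_left times_divide_eq_right)
qed

text \<open>Adding scalars to \<open>S m\<close> and \<open>S n\<close> does not change their
  commutator, and the scalar found in \<open>S_commutator\<close> is
  \<open>(m - n) * e (m + n)\<close> minus the cocycle; hence it is absorbed by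
  \<open>L (m + n)\<close>.\<close>

theorem L_commutator:
  "L m (L n v) - L n (L m v)
   = smul (of_int (m - n)) (L (m + n) v) - smul (if m + n = 0 then of_int (m ^ 3 - m) / 6 else 0) v"
proof -
  define e where "e n = of_int (n + 1) / 2 * C n Minus Plus + c_term n" for n
  have L: "L n u = S n u + smul (e n) u" for n u
    by (simp add: L_def normal_sum e_def scale_left_distrib)
  have "L m (L n v) - L n (L m v) = S m (S n v) - S n (S m v)"
    by (simp add: L S_add S_scale scale_right_distrib mult.commute)
  also have "\<dots> = smul (of_int (m - n)) (L (m + n) v) - smul (if m + n = 0 then of_int (m ^ 3 - m) / 6 else 0) v"
    unfolding S_commutator L e_def[symmetric]
    by (simp only: scale_left_diff_distrib scale_right_distrib scale_scale add_diff_eq)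
  finally show ?thesis .
qed

end

section \<open>Transfer to smooth modules\<close>

theorem lemma4p3:
  fixes A :: "int \<Rightarrow> complex^pm^pm"
    and smul :: "complex \<Rightarrow> 'v \<Rightarrow> 'v::ab_group_add"
    and \<rho> :: "(pm \<times> int) free_alg set \<Rightarrow> 'v \<Rightarrow> 'v"
    and m n :: int and v :: 'v
  assumes "sl2_connection A"
    and "smooth_SF_module A smul \<rho>"
  shows "L_op A smul \<rho> m (L_op A smul \<rho> n v) - L_op A smul \<rho> n (L_op A smul \<rho> m v)
       = smul (of_int (m - n)) (L_op A smul \<rho> (m + n) v)
         - smul (if m + n = 0 then of_int (m ^ 3 - m) / 6 else 0) v"
proof -
  have M: "SF_module A smul \<rho>"
    using assms(2) unfolding smooth_SF_module_def by blast
  interpret vector_space smul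
    using M unfolding SF_module_def by blast
  have lin: "module_hom smul smul (\<rho> (psi A a k))" for a k
    by (rule Vector_Spaces.linear.axioms(3)[OF rho_linear[OF M psi_closed]])
  obtain N where N: "\<And>k. k \<ge> N \<Longrightarrow> A k = 0"
    using assms(1) unfolding sl2_connection_def by blast
  \<comment> \<open>The defining relations of the algebra give the anticommutators, tracelessness
    gives the symmetry of \<open>C\<close>, and the finite pole order gives its bound.\<close>
  interpret smooth_modes smul "\<lambda>a k. \<rho> (psi A a k)" "\<lambda>k a b. Cmat A k $ a $ b"
  proof unfold_locales
    show "\<exists>N. \<forall>k\<ge>N. \<forall>a b. Cmat A k $ a $ b = 0"
      using N by (intro exI[of _ N]) (simp add: Cmat_def matrix_matrix_mult_def)
    show "\<exists>N. \<forall>n\<ge>N. \<forall>a. \<rho> (psi A a n) u = 0" for u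
      using assms(2) unfolding smooth_SF_module_def by blast
  qed (simp_all only: module_hom.add[OF lin] module_hom.scale[OF lin] rho_psi_anticomm[OF M] Cmat_sym[OF assms(1)])
  have "L_op A smul \<rho> = L"
    by (simp add: fun_eq_iff L_op_def L_def normal_term_def rho_normal_ord[OF M] c_const_def c_term_def)
  then show ?thesis
    using L_commutator by simp
qed

end
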